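(* Let $(M,g)$ be a spacetime, i.e. a connected $4$-dimensional Lorentzian manifold. Suppose that $(M,g)$ is conformally flat and generalized Ricci recurrent, i.e. $M$ is non-flat and its Ricci tensor $R_{jl}$ satisfies $$\nabla_i R_{jl}=A_iR_{jl}+B_ig_{jl}$$ for some non-zero $1$-forms $A_i$ and $B_i$ on $M$. Then $(M,g)$ is either a de Sitter spacetime or an anti-de Sitter spacetime.
   Context: All objects are smooth. $\nabla$ is the Levi-Civita connection of $g$ and $R_{jl}$ is the Ricci tensor. The Lorentzian metric $g$ has signature $(-,+,+,+)$. A pseudo-Riemannian manifold $(M,g)$ is called generalized Ricci recurrent if it is non-flat (its Riemann curvature tensor is not identically zero) and there exist two non-zero $1$-forms $A_i$ and $B_i$ on $M$ such that $\nabla_iR_{jl}=A_iR_{jl}+B_ig_{jl}$. Here "non-zero" means non-vanishing at every point of $M$. Conformally flat means that every point has a neighborhood on which $g$ is conformal to a flat metric. "De Sitter spacetime" means a spacetime of constant positive sectional curvature, and "anti-de Sitter spacetime" means a spacetime of constant negative sectional curvature. No completeness or global topological type is asserted. The sectional curvature of a nondegenerate plane spanned by $x,y$ is $K=\frac{g(R(x,y)y,x)}{g(x,x)g(y,y)-g(x,y)^2}$, with the sign of $R$ chosen so that the round sphere has $K>0$. *)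

theory Defs
  imports "HOL-Analysis.Analysis"
begin

subsection \<open>Smooth maps between Euclidean spaces\<close>

text \<open>Meant for open \<open>S\<close>.  Since the domain is finite-dimensional, having all directional
  derivatives \<open>k\<close> times continuously differentiable means that the derivative is.\<close>

primrec Ck_on :: "nat \<Rightarrow> 'a::euclidean_space set \<Rightarrow> ('a \<Rightarrow> 'b::real_normed_vector) \<Rightarrow> bool" where
  "Ck_on 0 S f \<longleftrightarrow> continuous_on S f"
| "Ck_on (Suc k) S f \<longleftrightarrow> (\<forall>x\<in>S. f differentiable (at x)) \<and>
     (\<forall>v. Ck_on k S (\<lambda>x. frechet_derivative f (at x) v))"

definition smooth_on :: "'a::euclidean_space set \<Rightarrow> ('a \<Rightarrow> 'b::real_normed_vector) \<Rightarrow> bool" where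
  "smooth_on S f \<longleftrightarrow> (\<forall>k. Ck_on k S f)"

subsection \<open>Smooth manifolds\<close>

text \<open>The manifold is the whole type \<open>'m\<close> (for spacetimes, a Hausdorff and second countable
  space), its smooth structure is given by an atlas.  A chart is a pair of its domain and its
  coordinate map; the values of the coordinate map outside the domain are irrelevant.\<close>

type_synonym ('m, 'n) chart = "'m set \<times> ('m \<Rightarrow> (real, 'n) vec)"

abbreviation chart_dom :: "('m, 'n::finite) chart \<Rightarrow> 'm set" where
  "chart_dom c \<equiv> fst c"

abbreviation chart_map :: "('m, 'n::finite) chart \<Rightarrow> 'm \<Rightarrow> real^'n" where
  "chart_map c \<equiv> snd c"

definition chart_image :: "('m, 'n::finite) chart \<Rightarrow> (real^'n) set" where
  "chart_image c = chart_map c ` chart_dom c"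

definition chart_inv :: "('m, 'n::finite) chart \<Rightarrow> real^'n \<Rightarrow> 'm" where
  "chart_inv c = inv_into (chart_dom c) (chart_map c)"

definition is_chart :: "('m::topological_space, 'n::finite) chart \<Rightarrow> bool" where
  "is_chart c \<longleftrightarrow> open (chart_dom c) \<and> open (chart_image c) \<and>
     homeomorphism (chart_dom c) (chart_image c) (chart_map c) (chart_inv c)"

definition transition :: "('m, 'n::finite) chart \<Rightarrow> ('m, 'n) chart \<Rightarrow> real^'n \<Rightarrow> real^'n" where
  "transition c d = chart_map d \<circ> chart_inv c"

definition smooth_atlas :: "('m::topological_space, 'n::finite) chart set \<Rightarrow> bool" where
  "smooth_atlas \<A> \<longleftrightarrow> (\<forall>c\<in>\<A>. is_chart c) \<and> (\<Union>c\<in>\<A>. chart_dom c) = UNIV \<and>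
     (\<forall>c\<in>\<A>. \<forall>d\<in>\<A>. smooth_on (chart_map c ` (chart_dom c \<inter> chart_dom d)) (transition c d))"

definition smooth_function_on ::
  "('m::topological_space, 'n::finite) chart set \<Rightarrow> 'm set \<Rightarrow> ('m \<Rightarrow> real) \<Rightarrow> bool" where
  "smooth_function_on \<A> W f \<longleftrightarrow>
     (\<forall>c\<in>\<A>. smooth_on (chart_map c ` (chart_dom c \<inter> W)) (\<lambda>x. f (chart_inv c x)))"

subsection \<open>Covariant tensor fields in components\<close>

text \<open>A covariant tensor field assigns to every chart \<open>c\<close> its components, as functions of the
  coordinates \<open>x \<in> chart_image c\<close>, subject to the tensor transformation law under change of
  charts: \<open>T\<^sub>i\<^sub>j = (\<partial>y\<^sup>a/\<partial>x\<^sup>i) (\<partial>y\<^sup>b/\<partial>x\<^sup>j) T'\<^sub>a\<^sub>b\<close>, where \<open>y\<close> is the transition map.\<close>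

type_synonym ('m, 'n) one_form = "('m, 'n) chart \<Rightarrow> (real, 'n) vec \<Rightarrow> (real, 'n) vec"

type_synonym ('m, 'n) tensor2 = "('m, 'n) chart \<Rightarrow> (real, 'n) vec \<Rightarrow> ((real, 'n) vec, 'n) vec"

definition smooth_one_form ::
  "('m::topological_space, 'n::finite) chart set \<Rightarrow> ('m, 'n) one_form \<Rightarrow> bool" where
  "smooth_one_form \<A> \<omega> \<longleftrightarrow> (\<forall>c\<in>\<A>. smooth_on (chart_image c) (\<omega> c)) \<and>
     (\<forall>c\<in>\<A>. \<forall>d\<in>\<A>. \<forall>x \<in> chart_map c ` (chart_dom c \<inter> chart_dom d).
        \<omega> c x = transpose (jacobian (transition c d) (at x)) *v \<omega> d (transition c d x))"

definition nowhere_vanishing ::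
  "('m, 'n::finite) chart set \<Rightarrow> ('m, 'n) one_form \<Rightarrow> bool" where
  "nowhere_vanishing \<A> \<omega> \<longleftrightarrow> (\<forall>c\<in>\<A>. \<forall>x\<in>chart_image c. \<omega> c x \<noteq> 0)"

definition smooth_tensor2 ::
  "('m::topological_space, 'n::finite) chart set \<Rightarrow> ('m, 'n) tensor2 \<Rightarrow> bool" where
  "smooth_tensor2 \<A> T \<longleftrightarrow> (\<forall>c\<in>\<A>. smooth_on (chart_image c) (T c)) \<and>
     (\<forall>c\<in>\<A>. \<forall>d\<in>\<A>. \<forall>x \<in> chart_map c ` (chart_dom c \<inter> chart_dom d).
        T c x = transpose (jacobian (transition c d) (at x)) ** T d (transition c d x) **
                jacobian (transition c d) (at x))"

subsection \<open>Pseudo-Riemannian and Lorentzian metrics\<close>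

definition bilin :: "real^'n^'n \<Rightarrow> real^'n::finite \<Rightarrow> real^'n \<Rightarrow> real" where
  "bilin G u v = u \<bullet> (G *v v)"

definition pseudo_riemannian_metric ::
  "('m::topological_space, 'n::finite) chart set \<Rightarrow> ('m, 'n) tensor2 \<Rightarrow> bool" where
  "pseudo_riemannian_metric \<A> g \<longleftrightarrow> smooth_tensor2 \<A> g \<and>
     (\<forall>c\<in>\<A>. \<forall>x\<in>chart_image c. transpose (g c x) = g c x \<and> invertible (g c x))"

text \<open>Signature \<open>(-,+,\<dots>,+)\<close>: there is an orthonormal frame \<open>e\<close> whose only timelike member
  is \<open>e t\<close>.\<close>

definition lorentz_signature :: "real^'n^'n::finite \<Rightarrow> bool" where
  "lorentz_signature G \<longleftrightarrow> (\<exists>(e :: 'n \<Rightarrow> real^'n) t. \<forall>i j.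
     bilin G (e i) (e j) = (if i \<noteq> j then 0 else if i = t then -1 else 1))"

definition lorentzian_metric ::
  "('m::topological_space, 'n::finite) chart set \<Rightarrow> ('m, 'n) tensor2 \<Rightarrow> bool" where
  "lorentzian_metric \<A> g \<longleftrightarrow> pseudo_riemannian_metric \<A> g \<and>
     (\<forall>c\<in>\<A>. \<forall>x\<in>chart_image c. lorentz_signature (g c x))"

subsection \<open>Levi-Civita connection and curvature in coordinates\<close>

text \<open>Here \<open>G\<close> is the matrix of metric components in one fixed chart, as a function of the
  coordinates.\<close>

definition partial_deriv :: "'n \<Rightarrow> (real^'n::finite \<Rightarrow> real) \<Rightarrow> real^'n \<Rightarrow> real" where
  "partial_deriv i f x = frechet_derivative f (at x) (axis i 1)"

text \<open>\<open>christoffel G k i j\<close> is \<open>\<Gamma>\<^sup>k\<^sub>i\<^sub>j\<close>, i.e. \<open>\<nabla>\<^sub>i \<partial>\<^sub>j = \<Gamma>\<^sup>k\<^sub>i\<^sub>j \<partial>\<^sub>k\<close> for the Levi-Civita connection.\<close>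

definition christoffel ::
  "(real^'n \<Rightarrow> real^'n^'n) \<Rightarrow> 'n \<Rightarrow> 'n \<Rightarrow> 'n \<Rightarrow> real^'n::finite \<Rightarrow> real" where
  "christoffel G k i j x = (1/2) * (\<Sum>l\<in>UNIV. matrix_inv (G x) $ k $ l *
     (partial_deriv i (\<lambda>y. G y $ j $ l) x + partial_deriv j (\<lambda>y. G y $ i $ l) x
      - partial_deriv l (\<lambda>y. G y $ i $ j) x))"

text \<open>\<open>riemann G l i j k\<close> is the coefficient of \<open>\<partial>\<^sub>l\<close> in
  \<open>R(\<partial>\<^sub>i,\<partial>\<^sub>j)\<partial>\<^sub>k = \<nabla>\<^sub>i\<nabla>\<^sub>j\<partial>\<^sub>k - \<nabla>\<^sub>j\<nabla>\<^sub>i\<partial>\<^sub>k\<close>.\<close>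

definition riemann ::
  "(real^'n \<Rightarrow> real^'n^'n) \<Rightarrow> 'n \<Rightarrow> 'n \<Rightarrow> 'n \<Rightarrow> 'n \<Rightarrow> real^'n::finite \<Rightarrow> real" where
  "riemann G l i j k x =
     partial_deriv i (christoffel G l j k) x - partial_deriv j (christoffel G l i k) x
     + (\<Sum>m\<in>UNIV. christoffel G m j k x * christoffel G l i m x
                   - christoffel G m i k x * christoffel G l j m x)"

text \<open>\<open>R\<^sub>j\<^sub>l\<close> is the trace of \<open>u \<mapsto> R(u,\<partial>\<^sub>j)\<partial>\<^sub>l\<close>; it is positive definite on the round sphere.\<close>

definition ricci :: "(real^'n \<Rightarrow> real^'n^'n) \<Rightarrow> real^'n::finite \<Rightarrow> real^'n^'n" where
  "ricci G x = (\<chi> j l. \<Sum>i\<in>UNIV. riemann G i i j l x)"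

text \<open>\<open>cov_deriv2 G T i j l\<close> is \<open>\<nabla>\<^sub>i T\<^sub>j\<^sub>l\<close>.\<close>

definition cov_deriv2 :: "(real^'n \<Rightarrow> real^'n^'n) \<Rightarrow> (real^'n \<Rightarrow> real^'n^'n) \<Rightarrow>
    'n \<Rightarrow> 'n \<Rightarrow> 'n \<Rightarrow> real^'n::finite \<Rightarrow> real" where
  "cov_deriv2 G T i j l x = partial_deriv i (\<lambda>y. T y $ j $ l) x
     - (\<Sum>m\<in>UNIV. christoffel G m i j x * T x $ m $ l)
     - (\<Sum>m\<in>UNIV. christoffel G m i l x * T x $ j $ m)"

definition curvature_op ::
  "(real^'n \<Rightarrow> real^'n^'n) \<Rightarrow> real^'n \<Rightarrow> real^'n \<Rightarrow> real^'n \<Rightarrow> real^'n \<Rightarrow> real^'n::finite" where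
  "curvature_op G x u v w =
     (\<chi> l. \<Sum>i\<in>UNIV. \<Sum>j\<in>UNIV. \<Sum>k\<in>UNIV. riemann G l i j k x * u $ i * v $ j * w $ k)"

definition area2 :: "real^'n^'n \<Rightarrow> real^'n \<Rightarrow> real^'n::finite \<Rightarrow> real" where
  "area2 G u v = bilin G u u * bilin G v v - (bilin G u v)\<^sup>2"

definition sectional ::
  "(real^'n \<Rightarrow> real^'n^'n) \<Rightarrow> real^'n \<Rightarrow> real^'n \<Rightarrow> real^'n::finite \<Rightarrow> real" where
  "sectional G x u v = bilin (G x) (curvature_op G x u v v) u / area2 (G x) u v"

subsection \<open>Flatness, conformal flatness, recurrence, constant curvature\<close>

definition flat_on :: "('m, 'n::finite) chart set \<Rightarrow> 'm set \<Rightarrow> ('m, 'n) tensor2 \<Rightarrow> bool" where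
  "flat_on \<A> W g \<longleftrightarrow> (\<forall>c\<in>\<A>. \<forall>x \<in> chart_map c ` (chart_dom c \<inter> W). \<forall>l i j k.
     riemann (g c) l i j k x = 0)"

definition rescale :: "('m \<Rightarrow> real) \<Rightarrow> ('m, 'n::finite) tensor2 \<Rightarrow> ('m, 'n) tensor2" where
  "rescale f g = (\<lambda>c x. f (chart_inv c x) *\<^sub>R g c x)"

definition conformally_flat ::
  "('m::topological_space, 'n::finite) chart set \<Rightarrow> ('m, 'n) tensor2 \<Rightarrow> bool" where
  "conformally_flat \<A> g \<longleftrightarrow> (\<forall>p. \<exists>W f. open W \<and> p \<in> W \<and>
     smooth_function_on \<A> W f \<and> (\<forall>q\<in>W. f q > 0) \<and> flat_on \<A> W (rescale f g))"

definition generalized_ricci_recurrent ::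
  "('m::topological_space, 'n::finite) chart set \<Rightarrow> ('m, 'n) tensor2 \<Rightarrow> bool" where
  "generalized_ricci_recurrent \<A> g \<longleftrightarrow> \<not> flat_on \<A> UNIV g \<and>
     (\<exists>A B. smooth_one_form \<A> A \<and> smooth_one_form \<A> B \<and>
        nowhere_vanishing \<A> A \<and> nowhere_vanishing \<A> B \<and>
        (\<forall>c\<in>\<A>. \<forall>x\<in>chart_image c. \<forall>i j l.
           cov_deriv2 (g c) (ricci (g c)) i j l x =
             A c x $ i * ricci (g c) x $ j $ l + B c x $ i * g c x $ j $ l))"

definition constant_sectional_curvature ::
  "('m, 'n::finite) chart set \<Rightarrow> ('m, 'n) tensor2 \<Rightarrow> real \<Rightarrow> bool" where
  "constant_sectional_curvature \<A> g K \<longleftrightarrow> (\<forall>c\<in>\<A>. \<forall>x\<in>chart_image c. \<forall>u v.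
     area2 (g c x) u v \<noteq> 0 \<longrightarrow> sectional (g c) x u v = K)"

definition spacetime ::
  "('m::{t2_space, second_countable_topology}, 4) chart set \<Rightarrow> ('m, 4) tensor2 \<Rightarrow> bool" where
  "spacetime \<A> g \<longleftrightarrow> connected (UNIV :: 'm set) \<and> smooth_atlas \<A> \<and> lorentzian_metric \<A> g"

definition de_sitter ::
  "('m::{t2_space, second_countable_topology}, 4) chart set \<Rightarrow> ('m, 4) tensor2 \<Rightarrow> bool" where
  "de_sitter \<A> g \<longleftrightarrow> spacetime \<A> g \<and> (\<exists>K>0. constant_sectional_curvature \<A> g K)"

definition anti_de_sitter ::
  "('m::{t2_space, second_countable_topology}, 4) chart set \<Rightarrow> ('m, 4) tensor2 \<Rightarrow> bool" where
  "anti_de_sitter \<A> g \<longleftrightarrow> spacetime \<A> g \<and> (\<exists>K<0. constant_sectional_curvature \<A> g K)"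

end

(* Since g is locally conformal to a flat metric, its Riemann tensor is the Kulkarni-Nomizu product of
   g with the Schouten tensor, and its Cotton tensor vanishes (the latter by the Ricci
   identity for the differential of the conformal factor).  Inserting the recurrence into the
   vanishing of the Cotton tensor gives, by linear algebra, Ric = mu g + nu A A and B = (s/2 - 3 mu) A,
   where s = 4 mu + N is the scalar curvature and N = nu |A|^2.  The Ricci identity for Ric then forces
   nu (mu + N) = 0.  Where nu does not vanish, the vector a dual to A is thus in the kernel of Ric, and
   differentiating Ric(a,a) = 0 gives B |A|^2 = 0, hence N = mu = s = 0 and B = 0, a contradiction.
   So nu = 0 everywhere, g is Einstein with ds = s A + 4 B = 0, and B = -(s/4) A shows s is nonzero. *)

theory Submission
  imports Defs
begin

subsection \<open>Calculus of smooth maps\<close>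

text \<open>A conformal factor exists only near each point. Its consequences are therefore pointwise
  identities on small patches inside a chart, and they extend to the chart because connection,
  curvature and Schouten tensor depend on the metric alone.

  If \<open>e^(2u) g\<close> is flat, the transformation law of the Schouten tensor forces that of
  \<open>g\<close> to be \<open>Hess u - du du + (|du|^2/2) g\<close>. The curvature computation is
  organised around this expression, and taking traces identifies it as the Schouten tensor
  afterwards.

  The obstacle in the algebra is that \<open>A\<close> may be null, so nothing can be split off by
  \<open>g\<close>-projection along \<open>A\<close>. The Euclidean inner product of chart
  components replaces it: it is positive on \<open>A\<close> and provides complements, while the
  identities obtained are still tensorial.

  The equation \<open>nu (mu + N) = 0\<close> is only a pointwise alternative. Its second branch is
  refuted by a derivative, hence on an open set where \<open>nu\<close> has no zero.\<close>

lemma Ck_on_cong: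
  assumes "open S" "\<And>x. x \<in> S \<Longrightarrow> f x = g x"
  shows "Ck_on k S f \<longleftrightarrow> Ck_on k S g"
  using assms(2)
proof (induction k arbitrary: f g)
  case 0
  then show ?case by (simp cong: continuous_on_cong)
next
  case (Suc k)
  have d: "f differentiable (at x) \<longleftrightarrow> g differentiable (at x)" if "x \<in> S" for x
    using has_derivative_transform_within_open[OF _ assms(1) that] Suc.prems
    unfolding differentiable_def by metis
  show ?case
  proof (cases "\<forall>x\<in>S. f differentiable (at x)")
    case True
    have "frechet_derivative f (at x) = frechet_derivative g (at x)" if "x \<in> S" for x
        by (rule frechet_derivative_transform_within_open[OF _ assms(1) that]) (use True that Suc.prems in auto)
    then have "Ck_on k S (\<lambda>x. frechet_derivative f (at x) v) \<longleftrightarrow>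
        Ck_on k S (\<lambda>x. frechet_derivative g (at x) v)" for v
      by (intro Suc.IH) simp
    with d show ?thesis by simp
  next
    case False
    then show ?thesis using d by auto
  qed
qed

lemma Ck_on_SucD: "Ck_on (Suc k) S f \<Longrightarrow> Ck_on k S f"
proof (induction k arbitrary: f)
  case 0
  then show ?case
    by (auto intro!: continuous_at_imp_continuous_on differentiable_imp_continuous_within)
next
  case (Suc k)
  have "f differentiable (at x)" if "x \<in> S" for x
    using Suc.prems that by simp
  moreover have "Ck_on k S (\<lambda>x. frechet_derivative f (at x) v)" for v
  proof (rule Suc.IH)
    show "Ck_on (Suc k) S (\<lambda>x. frechet_derivative f (at x) v)"
      using Suc.prems by (simp only: Ck_on.simps) blast
  qed
  ultimately show ?case by simp
qed

lemma Ck_on_subset: "Ck_on k S f \<Longrightarrow> T \<subseteq> S \<Longrightarrow> Ck_on k T f"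
  by (induction k arbitrary: f) (auto intro: continuous_on_subset)

lemma Ck_on_const: "Ck_on k S (\<lambda>x. c)"
  by (induction k arbitrary: c) auto

lemma Ck_on_add:
  assumes "open S" "Ck_on k S f" "Ck_on k S g"
  shows "Ck_on k S (\<lambda>x. f x + g x)"
  using assms(2,3)
proof (induction k arbitrary: f g)
  case (Suc k)
  have "frechet_derivative (\<lambda>x. f x + g x) (at x) v =
      frechet_derivative f (at x) v + frechet_derivative g (at x) v" if "x \<in> S" for x v
    using Suc.prems that
    by (subst frechet_derivative_at[OF has_derivative_add, symmetric])
       (auto simp: frechet_derivative_works[symmetric])
  then have "Ck_on k S (\<lambda>x. frechet_derivative (\<lambda>x. f x + g x) (at x) v)" for v
    using Suc by (subst Ck_on_cong[OF assms(1), of _ "\<lambda>x. frechet_derivative f (at x) v + frechet_derivative g (at x) v"]) auto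
  then show ?case using Suc.prems by auto
qed (auto intro: continuous_on_add)

text \<open>The product rule turns a derivative into two products of the same shape, so the
  induction closes when both factors vary. All products used later (scalar, inner, matrix-vector,
  matrix-matrix) are instances.\<close>

lemma Ck_on_bilinear:
  assumes "open S" "bounded_bilinear p" "Ck_on k S f" "Ck_on k S g"
  shows "Ck_on k S (\<lambda>x. p (f x) (g x))"
  using assms(3,4)
proof (induction k arbitrary: f g)
  case 0
  then show ?case by (auto intro: bounded_bilinear.continuous_on[OF assms(2)])
next
  case (Suc k)
  have D: "((\<lambda>x. p (f x) (g x)) has_derivative
      (\<lambda>v. p (f x) (frechet_derivative g (at x) v) + p (frechet_derivative f (at x) v) (g x))) (at x)"
    if "x \<in> S" for x
    using Suc.prems that
    by (intro bounded_bilinear.FDERIV[OF assms(2)]) (auto simp: frechet_derivative_works[symmetric])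
  have "Ck_on k S (\<lambda>x. p (f x) (frechet_derivative g (at x) v) + p (frechet_derivative f (at x) v) (g x))" for v
    using Suc.prems Suc.prems[THEN Ck_on_SucD] by (intro Ck_on_add[OF assms(1)] Suc.IH) auto
  then have "Ck_on k S (\<lambda>x. frechet_derivative (\<lambda>x. p (f x) (g x)) (at x) v)" for v
    using frechet_derivative_at[OF D, symmetric]
    by (subst Ck_on_cong[OF assms(1), of _ "\<lambda>x. p (f x) (frechet_derivative g (at x) v) + p (frechet_derivative f (at x) v) (g x)"])
       (auto simp: fun_eq_iff)
  then show ?case using D by (auto simp: differentiable_def)
qed

text \<open>The derivative of \<open>1/f\<close> is a product of \<open>1/f\<close>, a derivative of
  \<open>f\<close> and \<open>1/f\<close> again, so the induction hypothesis and the product lemma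
  suffice.\<close>

lemma Ck_on_inverse:
  fixes f :: "'a::euclidean_space \<Rightarrow> real"
  assumes "open S" "Ck_on k S f" "\<And>x. x \<in> S \<Longrightarrow> f x \<noteq> 0"
  shows "Ck_on k S (\<lambda>x. inverse (f x))"
  using assms(2)
proof (induction k)
  case 0
  then show ?case using assms(3) by (auto intro: continuous_on_inverse)
next
  case (Suc k)
  have D: "((\<lambda>x. inverse (f x)) has_derivative
      (\<lambda>v. - (inverse (f x) * frechet_derivative f (at x) v * inverse (f x)))) (at x)"
    if "x \<in> S" for x
    using Suc.prems that assms(3)
    by (intro Deriv.has_derivative_inverse) (auto simp: frechet_derivative_works[symmetric])
  have i: "Ck_on k S (\<lambda>x. inverse (f x))"
    using Suc by (auto dest: Ck_on_SucD simp del: Ck_on.simps)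
  have "Ck_on k S (\<lambda>x. (-1) * ((inverse (f x) * frechet_derivative f (at x) v) * inverse (f x)))" for v
    using Suc.prems
    by (intro Ck_on_bilinear[OF assms(1) bounded_bilinear_mult] Ck_on_const i) auto
  then have "Ck_on k S (\<lambda>x. frechet_derivative (\<lambda>x. inverse (f x)) (at x) v)" for v
    using frechet_derivative_at[OF D, symmetric]
    by (subst Ck_on_cong[OF assms(1), of _ "\<lambda>x. (-1) * ((inverse (f x) * frechet_derivative f (at x) v) * inverse (f x))"])
       (auto simp: fun_eq_iff)
  then show ?case using D by (auto simp: differentiable_def)
qed

lemma smooth_on_cong:
  "open S \<Longrightarrow> (\<And>x. x \<in> S \<Longrightarrow> f x = g x) \<Longrightarrow> smooth_on S f \<longleftrightarrow> smooth_on S g"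
  unfolding smooth_on_def using Ck_on_cong by blast

lemma smooth_on_subset: "smooth_on S f \<Longrightarrow> T \<subseteq> S \<Longrightarrow> smooth_on T f"
  unfolding smooth_on_def using Ck_on_subset by blast

lemma smooth_on_const: "smooth_on S (\<lambda>x. c)"
  by (simp add: smooth_on_def Ck_on_const)

lemma smooth_on_add: "open S \<Longrightarrow> smooth_on S f \<Longrightarrow> smooth_on S g \<Longrightarrow> smooth_on S (\<lambda>x. f x + g x)"
  by (simp add: smooth_on_def Ck_on_add)

lemma smooth_on_bilinear:
  "open S \<Longrightarrow> bounded_bilinear p \<Longrightarrow> smooth_on S f \<Longrightarrow> smooth_on S g \<Longrightarrow> smooth_on S (\<lambda>x. p (f x) (g x))"
  by (simp add: smooth_on_def Ck_on_bilinear)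

lemma smooth_on_inverse:
  fixes f :: "'a::euclidean_space \<Rightarrow> real"
  shows "open S \<Longrightarrow> smooth_on S f \<Longrightarrow> (\<And>x. x \<in> S \<Longrightarrow> f x \<noteq> 0) \<Longrightarrow> smooth_on S (\<lambda>x. inverse (f x))"
  by (simp add: smooth_on_def Ck_on_inverse)

lemmas smooth_on_mult = smooth_on_bilinear[OF _ bounded_bilinear_mult]
lemmas smooth_on_scaleR = smooth_on_bilinear[OF _ bounded_bilinear_scaleR]
lemmas smooth_on_inner = smooth_on_bilinear[OF _ bounded_bilinear_inner]

text \<open>The bilinear map \<open>(r, y)\<close> to \<open>r h(y)\<close>, evaluated at the
  constant \<open>r = 1\<close>, reduces this to products without another induction.\<close>

lemma smooth_on_linear:
  assumes "open S" "bounded_linear h" "smooth_on S f"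
  shows "smooth_on S (\<lambda>x. h (f x))"
proof -
  interpret h: bounded_linear h by fact
  have "bounded_bilinear (\<lambda>(r::real) y. r *\<^sub>R h y)"
    using bounded_bilinear.comp[OF bounded_bilinear_scaleR bounded_linear_ident assms(2)] by simp
  from smooth_on_bilinear[OF assms(1) this smooth_on_const[of S 1] assms(3)]
  show ?thesis by simp
qed

lemmas smooth_on_nth = smooth_on_linear[OF _ bounded_linear_vec_nth]

lemma smooth_on_minus: "open S \<Longrightarrow> smooth_on S f \<Longrightarrow> smooth_on S (\<lambda>x. - f x)"
  by (rule smooth_on_linear[OF _ bounded_linear_minus[OF bounded_linear_ident]])

lemma smooth_on_diff: "open S \<Longrightarrow> smooth_on S f \<Longrightarrow> smooth_on S g \<Longrightarrow> smooth_on S (\<lambda>x. f x - g x)"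
  using smooth_on_add[of S f "\<lambda>x. - g x"] smooth_on_minus[of S g] by simp

lemma smooth_on_divide:
  fixes f :: "'a::euclidean_space \<Rightarrow> real"
  shows "open S \<Longrightarrow> smooth_on S f \<Longrightarrow> smooth_on S g \<Longrightarrow> (\<And>x. x \<in> S \<Longrightarrow> g x \<noteq> 0) \<Longrightarrow>
    smooth_on S (\<lambda>x. f x / g x)"
  using smooth_on_mult[of S f "\<lambda>x. inverse (g x)"] smooth_on_inverse[of S g]
  by (simp add: divide_inverse)

lemma smooth_on_sum:
  assumes "open S" "\<And>i. i \<in> I \<Longrightarrow> smooth_on S (f i)"
  shows "smooth_on S (\<lambda>x. \<Sum>i\<in>I. f i x)"
  using assms(2)
  by (induction I rule: infinite_finite_induct)
     (auto intro: smooth_on_const smooth_on_add[OF assms(1)])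

lemma smooth_on_prod:
  fixes f :: "'i \<Rightarrow> 'a::euclidean_space \<Rightarrow> real"
  assumes "open S" "\<And>i. i \<in> I \<Longrightarrow> smooth_on S (f i)"
  shows "smooth_on S (\<lambda>x. \<Prod>i\<in>I. f i x)"
  using assms(2)
  by (induction I rule: infinite_finite_induct)
     (auto intro: smooth_on_const smooth_on_mult[OF assms(1)])

lemma smooth_on_vec_lambda:
  fixes f :: "'n::finite \<Rightarrow> 'a::euclidean_space \<Rightarrow> 'b::real_normed_vector"
  assumes "open S" "\<And>i. smooth_on S (f i)"
  shows "smooth_on S (\<lambda>x. \<chi> i. f i x)"
proof -
  have b: "bounded_linear (axis i :: 'b \<Rightarrow> 'b^'n)" for i
  proof (rule bounded_linear_intro[where K = 1])
    show "norm (axis i x) \<le> norm x * 1" for x :: 'b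
      by (simp add: norm_vec_def L2_set_def axis_def if_distrib[of norm] if_distrib[of "\<lambda>r. r\<^sup>2"] cong: if_cong)
  qed (auto simp: axis_def vec_eq_iff)
  have "smooth_on S (\<lambda>x. \<Sum>i\<in>UNIV. axis i (f i x))"
    by (intro smooth_on_sum smooth_on_linear[OF _ b] assms)
  also have "(\<lambda>x. \<Sum>i\<in>UNIV. axis i (f i x)) = (\<lambda>x. \<chi> i. f i x)"
    by (simp add: vec_eq_iff axis_def fun_eq_iff)
  finally show ?thesis .
qed

lemma smooth_on_det:
  fixes M :: "'a::euclidean_space \<Rightarrow> real^'n^'n::finite"
  assumes "open S" "smooth_on S M"
  shows "smooth_on S (\<lambda>x. det (M x))"
  unfolding det_def
  by (intro smooth_on_sum smooth_on_mult smooth_on_const smooth_on_prod smooth_on_nth assms)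

lemma smooth_on_differentiable: "smooth_on S f \<Longrightarrow> x \<in> S \<Longrightarrow> f differentiable (at x)"
  unfolding smooth_on_def by (drule spec[of _ "Suc 0"]) simp

lemma smooth_on_continuous: "smooth_on S f \<Longrightarrow> continuous_on S f"
  unfolding smooth_on_def by (drule spec[of _ 0]) simp

lemma smooth_on_frechet_derivative:
  assumes "smooth_on S f"
  shows "smooth_on S (\<lambda>x. frechet_derivative f (at x) v)"
  unfolding smooth_on_def
proof
  fix k show "Ck_on k S (\<lambda>x. frechet_derivative f (at x) v)"
    using assms unfolding smooth_on_def by (auto dest: spec[of _ "Suc k"])
qed

section \<open>Symmetry of second derivatives\<close>

lemma DERIV_along_line:
  fixes f :: "'a::real_normed_vector \<Rightarrow> real"
  assumes "f differentiable (at (c + s *\<^sub>R u))"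
  shows "((\<lambda>s. f (c + s *\<^sub>R u)) has_field_derivative frechet_derivative f (at (c + s *\<^sub>R u)) u) (at s)"
proof -
  have "((\<lambda>s. c + s *\<^sub>R u) has_derivative (\<lambda>h. h *\<^sub>R u)) (at s)"
    by (auto intro!: derivative_eq_intros)
  from has_derivative_compose[OF this assms[unfolded frechet_derivative_works]]
  have "((\<lambda>s. f (c + s *\<^sub>R u)) has_derivative (\<lambda>h. frechet_derivative f (at (c + s *\<^sub>R u)) (h *\<^sub>R u))) (at s)" .
  moreover have "(\<lambda>h. frechet_derivative f (at (c + s *\<^sub>R u)) (h *\<^sub>R u)) =
      (*) (frechet_derivative f (at (c + s *\<^sub>R u)) u)"
    using linear_frechet_derivative[OF assms] by (auto simp: linear_cmul mult.commute)
  ultimately show ?thesis by (simp add: has_field_derivative_def)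
qed

text \<open>The mean value theorem is applied twice: along \<open>u\<close> to the difference of
  \<open>f\<close> on two parallel segments, then along \<open>v\<close> to the derivative of
  \<open>f\<close> in direction \<open>u\<close>. The bound on \<open>t\<close> keeps the whole
  parallelogram inside the ball.\<close>

lemma second_difference_mvt:
  fixes f :: "'a::euclidean_space \<Rightarrow> real"
  assumes B: "ball x r \<subseteq> S" and f: "Ck_on 2 S f" and t: "t > 0" "t * (norm u + norm v) < r"
  shows "\<exists>p. dist x p < r \<and> f (x + t *\<^sub>R u + t *\<^sub>R v) - f (x + t *\<^sub>R u) - f (x + t *\<^sub>R v) + f x =
    t * t * frechet_derivative (\<lambda>y. frechet_derivative f (at y) u) (at p) v"
proof -
  let ?F = "\<lambda>y. frechet_derivative f (at y) u"
  have d1: "f differentiable (at y)" if "y \<in> S" for y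
    using f that by (auto simp: numeral_2_eq_2)
  have d2: "?F differentiable (at y)" if "y \<in> S" for y
    using f that by (auto simp: numeral_2_eq_2)
  have dist: "dist x (x + s *\<^sub>R u + s' *\<^sub>R v) < r" if "0 \<le> s" "s \<le> t" "0 \<le> s'" "s' \<le> t" for s s'
  proof -
    have "norm (s *\<^sub>R u + s' *\<^sub>R v) \<le> s * norm u + s' * norm v"
      by (rule order_trans[OF norm_triangle_ineq]) (use that in simp)
    also have "\<dots> \<le> t * norm u + t * norm v"
      using that by (intro add_mono mult_right_mono) auto
    also have "\<dots> < r" using t by (simp add: algebra_simps)
    finally show ?thesis by (simp add: dist_norm add.assoc flip: norm_minus_cancel[of "s *\<^sub>R u + _"])
  qed
  have inS: "x + s *\<^sub>R u + s' *\<^sub>R v \<in> S" if "0 \<le> s" "s \<le> t" "0 \<le> s'" "s' \<le> t" for s s'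
    using dist[OF that] B by (auto simp: mem_ball)
  let ?h = "\<lambda>s. f ((x + t *\<^sub>R v) + s *\<^sub>R u) - f (x + s *\<^sub>R u)"
  have "\<exists>s>0. s < t \<and> ?h t - ?h 0 = (t - 0) * (?F ((x + t *\<^sub>R v) + s *\<^sub>R u) - ?F (x + s *\<^sub>R u))"
  proof (rule MVT2[OF t(1)])
    fix s assume s: "0 \<le> s" "s \<le> t"
    have "x + t *\<^sub>R v + s *\<^sub>R u \<in> S" "x + s *\<^sub>R u \<in> S"
      using inS[OF s, of t] inS[OF s, of 0] t s by (auto simp: algebra_simps)
    then show "(?h has_field_derivative ?F ((x + t *\<^sub>R v) + s *\<^sub>R u) - ?F (x + s *\<^sub>R u)) (at s)"
      by (intro DERIV_diff DERIV_along_line d1)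
  qed
  then obtain s where s: "0 < s" "s < t"
    "?h t - ?h 0 = t * (?F ((x + t *\<^sub>R v) + s *\<^sub>R u) - ?F (x + s *\<^sub>R u))" by auto
  let ?k = "\<lambda>s'. ?F ((x + s *\<^sub>R u) + s' *\<^sub>R v)"
  have "\<exists>s'>0. s' < t \<and> ?k t - ?k 0 =
      (t - 0) * frechet_derivative ?F (at ((x + s *\<^sub>R u) + s' *\<^sub>R v)) v"
  proof (rule MVT2[OF t(1)])
    fix s' assume s': "0 \<le> s'" "s' \<le> t"
    then show "(?k has_field_derivative frechet_derivative ?F (at ((x + s *\<^sub>R u) + s' *\<^sub>R v)) v) (at s')"
      using s by (intro DERIV_along_line d2 inS) auto
  qed
  then obtain s' where s': "0 < s'" "s' < t"
    "?k t - ?k 0 = t * frechet_derivative ?F (at ((x + s *\<^sub>R u) + s' *\<^sub>R v)) v" by auto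
  let ?p = "(x + s *\<^sub>R u) + s' *\<^sub>R v"
  have "?h t - ?h 0 = t * t * frechet_derivative ?F (at ?p) v"
    using s(3) s'(3) by (simp add: algebra_simps)
  moreover have "dist x ?p < r" using s s' by (intro dist) auto
  ultimately show ?thesis by (intro exI[of _ ?p]) (simp add: algebra_simps)
qed

text \<open>The second difference is symmetric in \<open>u\<close> and \<open>v\<close>, so the two
  mixed derivatives agree at suitable points \<open>p\<close> and \<open>q\<close> near
  \<open>x\<close>. By continuity each is within \<open>e\<close>, half of the supposed gap, of its
  value at \<open>x\<close>, which is contradictory.\<close>

lemma second_derivative_commute:
  fixes f :: "'a::euclidean_space \<Rightarrow> real"
  assumes "open S" "x \<in> S" "Ck_on 2 S f"
  shows "frechet_derivative (\<lambda>y. frechet_derivative f (at y) u) (at x) v =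
    frechet_derivative (\<lambda>y. frechet_derivative f (at y) v) (at x) u"
proof (rule ccontr)
  let ?F = "\<lambda>u v p. frechet_derivative (\<lambda>y. frechet_derivative f (at y) u) (at p) v"
  assume "?F u v x \<noteq> ?F v u x"
  define e where "e = \<bar>?F u v x - ?F v u x\<bar> / 2"
  have "e > 0" using \<open>?F u v x \<noteq> ?F v u x\<close> by (simp add: e_def)
  have c: "isCont (?F u v) x" "isCont (?F v u) x" for u v
    using assms by (auto simp: numeral_2_eq_2 continuous_on_eq_continuous_at)
  obtain d1 where d1: "d1 > 0" "\<And>p. dist p x < d1 \<Longrightarrow> dist (?F u v p) (?F u v x) < e"
    using c(1) \<open>e > 0\<close> unfolding continuous_at_eps_delta by meson
  obtain d2 where d2: "d2 > 0" "\<And>p. dist p x < d2 \<Longrightarrow> dist (?F v u p) (?F v u x) < e"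
    using c(1)[of v u] \<open>e > 0\<close> unfolding continuous_at_eps_delta by meson
  obtain d3 where d3: "d3 > 0" "ball x d3 \<subseteq> S"
    using assms(1,2) openE by blast
  define r where "r = min d1 (min d2 d3)"
  have r: "r > 0" "ball x r \<subseteq> S" using d1 d2 d3 by (auto simp: r_def)
  \<comment> \<open>The summand 1 keeps the denominator positive and the inequality below strict
    even if \<open>u\<close> and \<open>v\<close> vanish.\<close>
  define t where "t = r / (2 * (norm u + norm v + 1))"
  have n: "norm u + norm v + 1 > 0" by (simp add: add_nonneg_pos)
  have t: "t > 0" using r n by (simp add: t_def)
  have "t * (norm u + norm v) < t * (2 * (norm u + norm v + 1))"
    using t n by (intro mult_strict_left_mono) (auto simp: algebra_simps add_nonneg_pos)
  also have "\<dots> = r" using n by (simp add: t_def)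
  finally have t': "t * (norm u + norm v) < r" "t * (norm v + norm u) < r"
    by (simp_all add: add.commute)
  obtain p where p: "dist x p < r" "f (x + t *\<^sub>R u + t *\<^sub>R v) - f (x + t *\<^sub>R u) - f (x + t *\<^sub>R v) + f x = t * t * ?F u v p"
    using second_difference_mvt[OF r(2) assms(3) t t'(1)] by blast
  obtain q where q: "dist x q < r" "f (x + t *\<^sub>R v + t *\<^sub>R u) - f (x + t *\<^sub>R v) - f (x + t *\<^sub>R u) + f x = t * t * ?F v u q"
    using second_difference_mvt[OF r(2) assms(3) t t'(2)] by blast
  have "f (x + t *\<^sub>R v + t *\<^sub>R u) = f (x + t *\<^sub>R u + t *\<^sub>R v)" by (simp add: algebra_simps)
  then have "t * t * ?F u v p = t * t * ?F v u q" using p(2) q(2) by linarith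
  then have "?F u v p = ?F v u q" using t by simp
  moreover have "dist (?F u v p) (?F u v x) < e" "dist (?F v u q) (?F v u x) < e"
    using d1(2)[of p] d2(2)[of q] p q by (auto simp: r_def dist_commute)
  ultimately show False unfolding e_def dist_real_def abs_if by (auto split: if_splits)
qed

text \<open>Values in any normed space are allowed, so that vector- and matrix-valued maps are
  differentiated as a whole instead of entry by entry.\<close>

definition pd :: "'n \<Rightarrow> (real^'n::finite \<Rightarrow> 'b::real_normed_vector) \<Rightarrow> real^'n \<Rightarrow> 'b" where
  "pd i f x = frechet_derivative f (at x) (axis i 1)"

lemma partial_deriv_eq_pd: "partial_deriv = pd"
  by (simp add: fun_eq_iff partial_deriv_def pd_def)

lemma smooth_on_pd: "smooth_on S f \<Longrightarrow> smooth_on S (pd i f)"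
  unfolding pd_def[abs_def] by (rule smooth_on_frechet_derivative)

lemma pd_cong:
  assumes "open S" "x \<in> S" "f differentiable (at x)" "\<And>y. y \<in> S \<Longrightarrow> f y = g y"
  shows "pd i f x = pd i g x"
  using frechet_derivative_transform_within_open[OF assms(3,1,2,4)] by (simp add: pd_def)

lemma pd_const [simp]: "pd i (\<lambda>x. c) x = 0"
  by (simp add: pd_def)

lemma pd_bilinear:
  assumes "bounded_bilinear p" "f differentiable (at x)" "g differentiable (at x)"
  shows "pd i (\<lambda>x. p (f x) (g x)) x = p (f x) (pd i g x) + p (pd i f x) (g x)"
  unfolding pd_def
  by (subst frechet_derivative_at[OF bounded_bilinear.FDERIV[OF assms(1)], symmetric])
     (use assms in \<open>auto simp: frechet_derivative_works[symmetric]\<close>)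

lemma pd_linear:
  assumes "bounded_linear h" "f differentiable (at x)"
  shows "pd i (\<lambda>x. h (f x)) x = h (pd i f x)"
  unfolding pd_def
  by (subst frechet_derivative_at[OF bounded_linear.has_derivative[OF assms(1)], symmetric])
     (use assms in \<open>auto simp: frechet_derivative_works[symmetric]\<close>)

lemmas pd_nth = pd_linear[OF bounded_linear_vec_nth]
lemmas pd_mult = pd_bilinear[OF bounded_bilinear_mult]
lemmas pd_scaleR = pd_bilinear[OF bounded_bilinear_scaleR]
lemmas pd_inner = pd_bilinear[OF bounded_bilinear_inner]

lemma pd_add:
  assumes "f differentiable (at x)" "g differentiable (at x)"
  shows "pd i (\<lambda>x. f x + g x) x = pd i f x + pd i g x"
  unfolding pd_def
  by (subst frechet_derivative_at[OF has_derivative_add, symmetric])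
     (use assms in \<open>auto simp: frechet_derivative_works[symmetric]\<close>)

lemma pd_diff:
  assumes "f differentiable (at x)" "g differentiable (at x)"
  shows "pd i (\<lambda>x. f x - g x) x = pd i f x - pd i g x"
  unfolding pd_def
  by (subst frechet_derivative_at[OF has_derivative_diff, symmetric])
     (use assms in \<open>auto simp: frechet_derivative_works[symmetric]\<close>)

lemma pd_commute:
  fixes f :: "real^'n::finite \<Rightarrow> real"
  assumes "open S" "x \<in> S" "smooth_on S f"
  shows "pd i (pd j f) x = pd j (pd i f) x"
  using second_derivative_commute[OF assms(1,2), of f] assms(3)
  by (simp add: pd_def[abs_def] smooth_on_def)

text \<open>Commutation is assumed for the components, which may themselves be vectors. Applying the
  lemma twice therefore reaches matrix-valued maps.\<close>

lemma pd_commute_vec: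
  fixes f :: "real^'n::finite \<Rightarrow> 'b::real_normed_vector^'m::finite"
  assumes "open S" "x \<in> S" "smooth_on S f"
    and "\<And>k. pd i (pd j (\<lambda>y. f y $ k)) x = pd j (pd i (\<lambda>y. f y $ k)) x"
  shows "pd i (pd j f) x = pd j (pd i f) x"
proof -
  have "pd i (pd j f) x $ k = pd i (pd j (\<lambda>y. f y $ k)) x" for i j k
  proof -
    have "pd i (pd j f) x $ k = pd i (\<lambda>y. pd j f y $ k) x"
      by (rule pd_nth[symmetric]) (use assms smooth_on_pd smooth_on_differentiable in blast)
    also have "\<dots> = pd i (pd j (\<lambda>y. f y $ k)) x"
    proof (rule pd_cong[OF assms(1,2)])
      show "(\<lambda>y. pd j f y $ k) differentiable at x"
        using assms smooth_on_pd smooth_on_nth smooth_on_differentiable by blast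
      show "pd j f y $ k = pd j (\<lambda>y. f y $ k) y" if "y \<in> S" for y
        by (rule pd_nth[symmetric]) (use assms that smooth_on_differentiable in blast)
    qed
    finally show ?thesis .
  qed
  with assms(4) show ?thesis by (simp add: vec_eq_iff)
qed


subsection \<open>Metrics on an open subset of Euclidean space\<close>

lemma matrix_add_rdistrib: "(A + B) ** C = (A ** C) + (B ** C)"
  by (vector matrix_matrix_mult_def sum.distrib[symmetric] field_simps)

lemma bounded_bilinear_matrix_vector_mult:
  "bounded_bilinear ((*v) :: real^'n::finite^'m::finite \<Rightarrow> real^'n \<Rightarrow> real^'m)"
  by (subst bilinear_conv_bounded_bilinear[symmetric])
     (auto simp: bilinear_def linear_iff algebra_simps scaleR_matrix_vector_assoc)

lemma bounded_bilinear_matrix_matrix_mult: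
  "bounded_bilinear ((**) :: real^'n::finite^'m::finite \<Rightarrow> real^'p::finite^'n \<Rightarrow> real^'p^'m)"
  by (subst bilinear_conv_bounded_bilinear[symmetric])
     (auto simp: bilinear_def linear_iff matrix_add_ldistrib matrix_add_rdistrib
       scalar_matrix_assoc matrix_scalar_ac)

lemmas smooth_on_matrix_vector_mult = smooth_on_bilinear[OF _ bounded_bilinear_matrix_vector_mult]
lemmas smooth_on_matrix_matrix_mult = smooth_on_bilinear[OF _ bounded_bilinear_matrix_matrix_mult]
lemmas pd_matrix_vector_mult = pd_bilinear[OF bounded_bilinear_matrix_vector_mult]
lemmas pd_matrix_matrix_mult = pd_bilinear[OF bounded_bilinear_matrix_matrix_mult]

lemma matrix_inv_mult:
  fixes A :: "'a::semiring_1^'n^'n"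
  assumes "invertible A"
  shows "A ** matrix_inv A = mat 1" "matrix_inv A ** A = mat 1"
  using someI_ex[OF assms[unfolded invertible_def]] unfolding matrix_inv_def by auto

text \<open>The columns of the inverse solve linear systems with unit vectors on the right. Cramer's
  rule exhibits the entries as quotients of polynomials, which is the source of smoothness of the
  inverse metric.\<close>

lemma matrix_inv_cramer:
  fixes A :: "real^'n^'n::finite"
  assumes "invertible A"
  shows "matrix_inv A = (\<chi> k l. det (\<chi> i j. if j = k then axis l 1 $ i else A $ i $ j) / det A)"
proof -
  have d: "det A \<noteq> 0" using assms invertible_det_nz by blast
  have "A *v (matrix_inv A *v axis l 1) = axis l 1" for l
    by (simp add: matrix_vector_mul_assoc matrix_inv_mult assms)
  then have "matrix_inv A *v axis l 1 = (\<chi> k. det (\<chi> i j. if j = k then axis l 1 $ i else A $ i $ j) / det A)" for l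
    using cramer[OF d] by blast
  moreover have "(matrix_inv A *v axis l 1) $ k = matrix_inv A $ k $ l" for k l
    by (simp add: matrix_vector_mul_component inner_axis)
  ultimately show ?thesis by (simp add: vec_eq_iff)
qed

lemma smooth_on_matrix_inv:
  fixes M :: "'a::euclidean_space \<Rightarrow> real^'n^'n::finite"
  assumes "open S" "smooth_on S M" "\<And>x. x \<in> S \<Longrightarrow> invertible (M x)"
  shows "smooth_on S (\<lambda>x. matrix_inv (M x))"
proof (subst smooth_on_cong[OF assms(1) matrix_inv_cramer[OF assms(3)]], assumption)
  have entry: "smooth_on S (\<lambda>x. if j = k then c else M x $ i $ j)" for i j k and c :: real
    by (cases "j = k") (simp_all add: smooth_on_const smooth_on_nth assms)
  show "smooth_on S (\<lambda>x. \<chi> k l. det (\<chi> i j. if j = k then axis l 1 $ i else M x $ i $ j) / det (M x))"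
    using assms invertible_det_nz
    by (intro smooth_on_vec_lambda smooth_on_divide smooth_on_det entry assms(1)) auto
qed

text \<open>The connection matrix in direction \<open>i\<close>: on vector fields the covariant
  derivative is \<open>pd i\<close> plus this matrix. \<open>Rm\<close> below is the curvature of
  this matrix-valued connection form, as an endomorphism for each pair of labels.\<close>

definition Gam :: "(real^'n \<Rightarrow> real^'n^'n) \<Rightarrow> 'n::finite \<Rightarrow> real^'n \<Rightarrow> real^'n^'n" where
  "Gam G i x = (\<chi> k j. christoffel G k i j x)"

definition Rm :: "(real^'n \<Rightarrow> real^'n^'n) \<Rightarrow> 'n::finite \<Rightarrow> 'n \<Rightarrow> real^'n \<Rightarrow> real^'n^'n" where
  "Rm G i j x = pd i (Gam G j) x - pd j (Gam G i) x + Gam G i x ** Gam G j x - Gam G j x ** Gam G i x"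

text \<open>\<open>nabla G i T\<close> is the matrix \<open>(\<nabla>\<^sub>i T)\<^sub>j\<^sub>l\<close>.  Here and in \<open>Rm\<close> the index \<open>i\<close> is a mere label, so
  that covariant derivatives are matrix expressions and the Ricci identity for \<open>nabla\<close> has no
  Christoffel terms in that index.\<close>

definition nabla :: "(real^'n \<Rightarrow> real^'n^'n) \<Rightarrow> 'n::finite \<Rightarrow> (real^'n \<Rightarrow> real^'n^'n) \<Rightarrow> real^'n \<Rightarrow> real^'n^'n" where
  "nabla G i T x = pd i T x - transpose (Gam G i x) ** T x - T x ** Gam G i x"

abbreviation "E i \<equiv> axis i (1::real)"

lemma inner_transpose_matrix: "u \<bullet> (transpose M *v v) = (M *v u) \<bullet> (v :: real^'n::finite)"
  by (metis dot_lmul_matrix inner_commute transpose_matrix_vector)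

lemma matrix_eq_inner:
  fixes M N :: "real^'n::finite^'m::finite"
  shows "M = N \<longleftrightarrow> (\<forall>u v. u \<bullet> (M *v v) = u \<bullet> (N *v v))"
  by (metis matrix_eq vector_eq_ldot)

lemma nth_eq_inner: "(M :: real^'n::finite^'m::finite) $ k $ l = E k \<bullet> (M *v E l)"
  by (simp add: inner_axis' inner_axis matrix_vector_mul_component)

lemma cov_deriv2_eq_nabla:
  assumes "T differentiable (at x)"
  shows "cov_deriv2 G T i j l x = nabla G i T x $ j $ l"
proof -
  have d: "(\<lambda>y. T y $ j) differentiable (at x)"
    using assms bounded_linear.has_derivative[OF bounded_linear_vec_nth]
    unfolding differentiable_def by blast
  have "pd i (\<lambda>y. T y $ j $ l) x = pd i T x $ j $ l"
    using pd_nth[OF d] pd_nth[OF assms] by simp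
  then show ?thesis
    by (simp add: cov_deriv2_def nabla_def partial_deriv_eq_pd matrix_matrix_mult_def
        transpose_def Gam_def mult.commute)
qed

section \<open>Levi-Civita connection and curvature of a metric in coordinates\<close>

locale metric_patch =
  fixes S :: "(real^'n::finite) set" and G :: "real^'n \<Rightarrow> real^'n^'n"
  assumes open_S: "open S"
    and smooth_G: "smooth_on S G"
    and sym_G: "x \<in> S \<Longrightarrow> transpose (G x) = G x"
    and invertible_G: "x \<in> S \<Longrightarrow> invertible (G x)"
begin

definition "H x = matrix_inv (G x)"

lemma G_H: "x \<in> S \<Longrightarrow> G x ** H x = mat 1" "x \<in> S \<Longrightarrow> H x ** G x = mat 1"
  by (simp_all add: H_def matrix_inv_mult invertible_G)

lemma G_H_vec [simp]: "x \<in> S \<Longrightarrow> G x *v (H x *v v) = v" "x \<in> S \<Longrightarrow> H x *v (G x *v v) = v"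
  by (simp_all add: matrix_vector_mul_assoc G_H)

lemma G_inner: "x \<in> S \<Longrightarrow> (G x *v u) \<bullet> v = u \<bullet> (G x *v v)"
  by (metis inner_transpose_matrix sym_G)

lemma H_inner: "x \<in> S \<Longrightarrow> (H x *v u) \<bullet> v = u \<bullet> (H x *v v)"
  by (metis G_H_vec(1) G_inner)

lemma smooth_H: "smooth_on S H"
  unfolding H_def[abs_def] by (intro smooth_on_matrix_inv open_S smooth_G invertible_G)

lemma smooth_G_nth: "smooth_on S (\<lambda>x. G x $ i $ j)"
  by (intro smooth_on_nth open_S smooth_G)

lemma G_nth_commute: "x \<in> S \<Longrightarrow> G x $ i $ j = G x $ j $ i"
  using arg_cong[OF sym_G, of x "\<lambda>M. M $ j $ i"] by (simp add: transpose_def)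

lemma pd_G_commute: "x \<in> S \<Longrightarrow> pd k (\<lambda>y. G y $ i $ j) x = pd k (\<lambda>y. G y $ j $ i) x"
  by (rule pd_cong[OF open_S])
     (auto intro: smooth_on_differentiable[OF smooth_G_nth] G_nth_commute)

lemma smooth_christoffel: "smooth_on S (christoffel G k i j)"
  unfolding christoffel_def[abs_def] partial_deriv_eq_pd
  by (intro smooth_on_mult smooth_on_const smooth_on_sum smooth_on_add smooth_on_diff
      smooth_on_pd open_S smooth_G_nth smooth_on_nth smooth_H[unfolded H_def[abs_def]])

lemma smooth_Gam: "smooth_on S (Gam G i)"
  unfolding Gam_def[abs_def] by (intro smooth_on_vec_lambda open_S smooth_christoffel)

text \<open>Torsion-freeness, expressed on coordinate vectors.\<close>

lemma Gam_commute: "x \<in> S \<Longrightarrow> Gam G i x *v E j = Gam G j x *v E i"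
  by (simp add: vec_eq_iff matrix_vector_mul_component inner_axis Gam_def christoffel_def
      partial_deriv_eq_pd pd_G_commute[of x _ i j] add.commute)

text \<open>Lowering the upper index removes the inverse matrix and leaves the Christoffel symbols
  of the first kind.\<close>

lemma G_Gam:
  assumes "x \<in> S"
  shows "G x ** Gam G i x = (\<chi> l j. (1/2) * (partial_deriv i (\<lambda>y. G y $ j $ l) x
    + partial_deriv j (\<lambda>y. G y $ i $ l) x - partial_deriv l (\<lambda>y. G y $ i $ j) x))"
    (is "_ = ?L")
proof -
  have "Gam G i x = H x ** ?L"
    by (simp add: vec_eq_iff Gam_def christoffel_def H_def matrix_matrix_mult_def
        sum_distrib_left mult_ac)
  then show ?thesis by (simp add: matrix_mul_assoc G_H assms)
qed

text \<open>Metric compatibility. In the symmetrised symbols of the first kind all derivatives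
  cancel except those in direction \<open>i\<close>.\<close>

lemma nabla_G:
  assumes "x \<in> S"
  shows "pd i G x = transpose (Gam G i x) ** G x + G x ** Gam G i x"
proof -
  have "transpose (Gam G i x) ** G x = transpose (G x ** Gam G i x)"
    by (simp add: matrix_transpose_mul sym_G assms)
  moreover have "pd i (\<lambda>y. G y $ k $ l) x = pd i G x $ k $ l" for k l
    using pd_nth[of G x i k] pd_nth[of "\<lambda>y. G y $ k" x i l] assms
      smooth_on_differentiable[OF smooth_G] smooth_on_differentiable[OF smooth_on_nth[OF open_S smooth_G]]
    by simp
  ultimately show ?thesis
    by (simp add: vec_eq_iff G_Gam assms transpose_def partial_deriv_eq_pd field_simps)
       (metis pd_G_commute[OF assms])
qed

lemma pd_G_inner:
  assumes "x \<in> S"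
  shows "u \<bullet> (pd i G x *v v) = (Gam G i x *v u) \<bullet> (G x *v v) + (G x *v u) \<bullet> (Gam G i x *v v)"
  by (simp add: nabla_G assms algebra_simps inner_transpose_matrix G_inner
      del: transpose_matrix_vector flip: matrix_vector_mul_assoc)

lemma riemann_eq_Rm:
  assumes "x \<in> S"
  shows "riemann G l i j k x = Rm G i j x $ l $ k"
proof -
  have "pd i (christoffel G l j k) x = pd i (Gam G j) x $ l $ k" for i j
  proof -
    have "christoffel G l j k = (\<lambda>y. Gam G j y $ l $ k)" by (simp add: Gam_def)
    then show ?thesis
      using pd_nth[of "Gam G j" x i l] pd_nth[of "\<lambda>y. Gam G j y $ l" x i k] assms
        smooth_on_differentiable[OF smooth_Gam] smooth_on_differentiable[OF smooth_on_nth[OF open_S smooth_Gam]]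
      by simp
  qed
  then show ?thesis
    by (simp add: riemann_def Rm_def partial_deriv_eq_pd matrix_matrix_mult_def Gam_def
        sum_subtractf mult.commute)
qed

end


subsection \<open>Conformally flat metrics\<close>

lemma bounded_bilinear_vector_matrix_mult:
  "bounded_bilinear ((v*) :: real^'m::finite \<Rightarrow> real^'n::finite^'m \<Rightarrow> real^'n)"
  by (subst bilinear_conv_bounded_bilinear[symmetric])
     (auto simp: bilinear_def linear_iff algebra_simps scaleR_vector_matrix_assoc
       vector_matrix_mult_def vec_eq_iff sum_distrib_left sum.distrib)

lemma pd_const_matrix_vector_mult:
  fixes M :: "real^'k::finite \<Rightarrow> real^'n::finite^'m::finite"
  assumes "M differentiable (at x)"
  shows "pd i (\<lambda>y. M y *v w) x = pd i M x *v w"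
  using pd_matrix_vector_mult[OF assms, of "\<lambda>_. w"] by simp

lemma pd_const_inner:
  assumes "f differentiable (at x)"
  shows "pd i (\<lambda>y. f y \<bullet> w) x = pd i f x \<bullet> w"
  using pd_inner[OF assms, of "\<lambda>_. w"] by simp

lemma (in metric_patch) Rm_apply:
  assumes "x \<in> S"
  shows "Rm G i j x *v w = pd i (Gam G j) x *v w - pd j (Gam G i) x *v w
    + Gam G i x *v (Gam G j x *v w) - Gam G j x *v (Gam G i x *v w)"
  by (simp add: Rm_def algebra_simps matrix_vector_mul_assoc)

locale conformally_flat_patch = metric_patch S G for S :: "(real^'n::finite) set" and G +
  fixes f :: "real^'n::finite \<Rightarrow> real"
  assumes smooth_f: "smooth_on S f"
    and f_pos: "x \<in> S \<Longrightarrow> f x > 0"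
    and flat: "x \<in> S \<Longrightarrow> riemann (\<lambda>y. f y *\<^sub>R G y) l i j k x = 0"
begin

text \<open>Every fact about metrics becomes available for the rescaled metric too, under the prefix
  \<open>conf\<close>.\<close>

sublocale conf: metric_patch S "\<lambda>y. f y *\<^sub>R G y"
proof
  show "smooth_on S (\<lambda>y. f y *\<^sub>R G y)"
    by (intro smooth_on_scaleR open_S smooth_f smooth_G)
  show "transpose (f x *\<^sub>R G x) = f x *\<^sub>R G x" if "x \<in> S" for x
    by (simp add: transpose_scalar sym_G that)
  show "invertible (f x *\<^sub>R G x)" if "x \<in> S" for x
    using f_pos[OF that] by (intro scalar_invertible invertible_G that) auto
qed (rule open_S)

text \<open>\<open>phi\<close> is the differential of \<open>(ln f) / 2\<close>, and \<open>P i\<close> the \<open>i\<close>-th row of what turns out to be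
  the Schouten tensor.\<close>

definition "phi x = (\<chi> i. pd i f x / (2 * f x))"
text \<open>\<open>xi\<close> is the gradient vector dual to \<open>phi\<close>, and
  \<open>Dphi i\<close> the covariant derivative of the 1-form \<open>phi\<close> in direction
  \<open>i\<close>.\<close>

definition "xi x = H x *v phi x"
definition "Dphi i x = pd i phi x - phi x v* Gam G i x"
definition "P i x = Dphi i x - (phi x $ i) *\<^sub>R phi x + ((1/2) * (phi x \<bullet> xi x)) *\<^sub>R (G x *v E i)"

lemma smooth_phi: "smooth_on S phi"
  unfolding phi_def[abs_def] using f_pos
  by (intro smooth_on_vec_lambda smooth_on_divide smooth_on_mult smooth_on_const smooth_on_pd
      smooth_f open_S) fastforce

lemma smooth_xi: "smooth_on S xi"
  unfolding xi_def[abs_def] by (intro smooth_on_matrix_vector_mult open_S smooth_H smooth_phi)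

lemmas differentiable =
  smooth_on_differentiable[OF smooth_phi] smooth_on_differentiable[OF smooth_xi]
  smooth_on_differentiable[OF smooth_Gam] smooth_on_differentiable[OF smooth_G]
  smooth_on_differentiable[OF smooth_f]

lemma G_xi: "x \<in> S \<Longrightarrow> G x *v xi x = phi x"
  by (simp add: xi_def)

text \<open>Clearing the denominator gives \<open>pd j f = 2 f phi_j\<close>. Differentiating this
  expresses \<open>pd i phi_j\<close> by the Hessian of \<open>f\<close> and a product symmetric in
  \<open>i\<close> and \<open>j\<close>, without using a logarithm.\<close>

lemma phi_closed:
  assumes "x \<in> S"
  shows "pd i phi x $ j = pd j phi x $ i"
proof -
  have "pd i phi x $ j = pd i (pd j f) x / (2 * f x) - 2 * phi x $ i * phi x $ j" for i j
  proof -
    have dj: "pd j f differentiable (at x)" and df: "f differentiable (at x)"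
      using smooth_on_differentiable[OF smooth_on_pd[OF smooth_f] assms] differentiable assms by auto
    have dphi: "(\<lambda>y. phi y $ j) differentiable (at x)"
      using smooth_on_differentiable[OF smooth_on_nth[OF open_S smooth_phi] assms] .
    have "pd i (pd j f) x = pd i (\<lambda>y. 2 * (f y * phi y $ j)) x"
      by (rule pd_cong[OF open_S assms dj]) (use f_pos in \<open>force simp: phi_def\<close>)
    also have "\<dots> = 2 * pd i (\<lambda>y. f y * phi y $ j) x"
      by (rule pd_linear[OF bounded_linear_mult_right]) (intro differentiable_mult df dphi)
    also have "\<dots> = 2 * (f x * pd i phi x $ j + pd i f x * phi x $ j)"
      using pd_mult[OF df dphi, of i] pd_nth[OF differentiable(1)[OF assms], of i j] by simp
    also have "\<dots> = 2 * (f x * pd i phi x $ j + (2 * f x * phi x $ i) * phi x $ j)"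
      using f_pos[OF assms] by (simp add: phi_def)
    finally show ?thesis using f_pos[OF assms] by (simp add: field_simps)
  qed
  then show ?thesis using pd_commute[OF open_S assms smooth_f, of i j] by simp
qed

lemma pd_phi: "pd i phi x \<bullet> w = Dphi i x \<bullet> w + phi x \<bullet> (Gam G i x *v w)"
  by (simp add: Dphi_def algebra_simps inner_diff_left dot_lmul_matrix)

lemma pd_phi_nth: "pd i phi x $ j = Dphi i x \<bullet> E j + phi x \<bullet> (Gam G i x *v E j)"
  using pd_phi[of i x "E j"] by (simp add: inner_axis)

lemma Dphi_commute: "x \<in> S \<Longrightarrow> Dphi i x \<bullet> E j = Dphi j x \<bullet> E i"
  using phi_closed[of x i j] Gam_commute[of x i j] by (simp add: pd_phi_nth)

text \<open>Raising an index commutes with covariant differentiation; the formula results from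
  differentiating \<open>G xi = phi\<close>.\<close>

lemma pd_xi:
  assumes "x \<in> S"
  shows "pd i xi x = H x *v Dphi i x - Gam G i x *v xi x"
proof -
  have "pd i phi x = pd i (\<lambda>y. G y *v xi y) x"
    by (rule pd_cong[OF open_S assms]) (auto simp: G_xi assms differentiable)
  also have "\<dots> = G x *v pd i xi x + pd i G x *v xi x"
    by (rule pd_matrix_vector_mult) (auto simp: assms differentiable)
  finally have eq: "G x *v pd i xi x = pd i phi x - pd i G x *v xi x" by simp
  have "u \<bullet> (G x *v pd i xi x) = u \<bullet> (G x *v (H x *v Dphi i x - Gam G i x *v xi x))" for u
    using pd_phi[of i x u] unfolding eq
    by (simp add: inner_diff_right pd_G_inner assms G_xi algebra_simps G_inner inner_commute)
  then have "G x *v pd i xi x = G x *v (H x *v Dphi i x - Gam G i x *v xi x)"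
    using vector_eq_ldot by blast
  then show ?thesis using G_H_vec(2)[OF assms] by metis
qed

text \<open>The classical change of the Levi-Civita connection under rescaling. \<open>T\<close> is
  the candidate for the difference of the two connections.\<close>

lemma conf_Gam:
  assumes "x \<in> S"
  shows "Gam (\<lambda>y. f y *\<^sub>R G y) i x *v w = Gam G i x *v w + (phi x $ i) *\<^sub>R w + (phi x \<bullet> w) *\<^sub>R E i
    - ((G x *v E i) \<bullet> w) *\<^sub>R xi x"
proof -
  define T where "T = (\<chi> k j. phi x $ i * (if k = j then 1 else 0) + (if k = i then 1 else 0) * phi x $ j - xi x $ k * G x $ i $ j)"
  have T: "T *v w = (phi x $ i) *\<^sub>R w + (phi x \<bullet> w) *\<^sub>R E i - ((G x *v E i) \<bullet> w) *\<^sub>R xi x" for w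
  proof -
    have "(G x *v E i) \<bullet> w = (\<Sum>j\<in>UNIV. G x $ i $ j * w $ j)"
      unfolding G_inner[OF assms] by (simp add: inner_axis' matrix_vector_mult_def)
    then show ?thesis
      by (simp add: vec_eq_iff T_def matrix_vector_mult_def axis_def inner_vec_def
          algebra_simps sum.distrib sum_subtractf sum_distrib_left sum_distrib_right
          if_distrib[of "\<lambda>r. _ * r"] cong: if_cong)
  qed
  \<comment> \<open>Both sides are compared after lowering with the rescaled metric, where the
    symbols of the first kind involve only first derivatives of \<open>f\<close> and
    \<open>G\<close>.\<close>
  have fG: "(f x *\<^sub>R G x) ** Gam (\<lambda>y. f y *\<^sub>R G y) i x = (f x *\<^sub>R G x) ** (Gam G i x + T)"
  proof -
    have pd: "partial_deriv k (\<lambda>y. (f y *\<^sub>R G y) $ a $ b) x =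
        f x * partial_deriv k (\<lambda>y. G y $ a $ b) x + (2 * f x * phi x $ k) * G x $ a $ b" for k a b
      using pd_mult[OF differentiable(5)[OF assms] smooth_on_differentiable[OF smooth_G_nth assms], of k a b]
        f_pos[OF assms] by (simp add: partial_deriv_eq_pd phi_def)
    have "(G x ** T) $ l $ j = phi x $ i * G x $ l $ j + G x $ l $ i * phi x $ j - phi x $ l * G x $ i $ j" for l j
    proof -
      have "(G x ** T) $ l $ j = E l \<bullet> (G x *v (T *v E j))"
        by (simp add: nth_eq_inner matrix_vector_mul_assoc)
      also have "\<dots> = phi x $ i * (E l \<bullet> (G x *v E j)) + phi x $ j * (E l \<bullet> (G x *v E i)) - ((G x *v E i) \<bullet> E j) * (E l \<bullet> phi x)"
        by (simp add: T algebra_simps inner_add_right inner_diff_right G_xi assms inner_axis)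
      finally show ?thesis
        by (simp add: G_inner assms flip: nth_eq_inner) (simp add: inner_axis')
    qed
    then have GT: "G x ** T = (\<chi> l j. phi x $ i * G x $ l $ j + G x $ l $ i * phi x $ j - phi x $ l * G x $ i $ j)"
      by (simp add: vec_eq_iff)
    show ?thesis
      unfolding conf.G_Gam[OF assms] pd
      by (simp add: matrix_add_ldistrib G_Gam assms GT vec_eq_iff G_nth_commute[OF assms]
          flip: scalar_matrix_assoc) (simp add: field_simps G_nth_commute[OF assms])
  qed
  have "Gam (\<lambda>y. f y *\<^sub>R G y) i x = Gam G i x + T"
    using arg_cong[OF fG, of "\<lambda>M. conf.H x ** M"] conf.G_H(2)[OF assms] by (simp add: matrix_mul_assoc)
  then show ?thesis by (simp add: T algebra_simps)
qed

lemma conf_Rm: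
  assumes "x \<in> S"
  shows "Rm (\<lambda>y. f y *\<^sub>R G y) i j x = 0"
  using flat[OF assms] by (simp add: conf.riemann_eq_Rm assms vec_eq_iff)

lemma pd_conf_Gam:
  assumes x: "x \<in> S"
  shows "pd i (Gam (\<lambda>y. f y *\<^sub>R G y) j) x *v w = pd i (Gam G j) x *v w + (pd i phi x $ j) *\<^sub>R w
    + (pd i phi x \<bullet> w) *\<^sub>R E j
    - ((pd i G x *v E j) \<bullet> w) *\<^sub>R xi x - ((G x *v E j) \<bullet> w) *\<^sub>R pd i xi x"
proof -
  have s: "smooth_on S (\<lambda>y. Gam G j y *v w)" "smooth_on S (\<lambda>y. (phi y $ j) *\<^sub>R w)"
    "smooth_on S (\<lambda>y. (phi y \<bullet> w) *\<^sub>R E j)" "smooth_on S (\<lambda>y. ((G y *v E j) \<bullet> w) *\<^sub>R xi y)"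
    "smooth_on S (\<lambda>y. (G y *v E j) \<bullet> w)" "smooth_on S (\<lambda>y. G y *v E j)"
    "smooth_on S (\<lambda>y. phi y $ j)" "smooth_on S (\<lambda>y. phi y \<bullet> w)"
    by (intro smooth_on_matrix_vector_mult smooth_on_scaleR smooth_on_inner smooth_on_nth
        smooth_on_const open_S smooth_Gam smooth_G smooth_phi smooth_xi)+
  note d = s[THEN smooth_on_differentiable, OF x]
  have "pd i (Gam (\<lambda>y. f y *\<^sub>R G y) j) x *v w = pd i (\<lambda>y. Gam (\<lambda>y. f y *\<^sub>R G y) j y *v w) x"
    by (rule pd_const_matrix_vector_mult[symmetric])
       (use smooth_on_differentiable[OF conf.smooth_Gam x] in simp)
  also have "\<dots> = pd i (\<lambda>y. Gam G j y *v w + (phi y $ j) *\<^sub>R w + (phi y \<bullet> w) *\<^sub>R E j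
      - ((G y *v E j) \<bullet> w) *\<^sub>R xi y) x"
    by (rule pd_cong[OF open_S x])
       (auto simp: conf_Gam intro!: smooth_on_differentiable[OF _ x] smooth_on_matrix_vector_mult
         open_S conf.smooth_Gam smooth_on_const)
  also have "\<dots> = pd i (\<lambda>y. Gam G j y *v w) x + pd i (\<lambda>y. (phi y $ j) *\<^sub>R w) x
      + pd i (\<lambda>y. (phi y \<bullet> w) *\<^sub>R E j) x - pd i (\<lambda>y. ((G y *v E j) \<bullet> w) *\<^sub>R xi y) x"
    by (simp add: pd_add pd_diff d differentiable_add)
  also have "\<dots> = pd i (Gam G j) x *v w + (pd i phi x $ j) *\<^sub>R w + (pd i phi x \<bullet> w) *\<^sub>R E j
    - ((pd i G x *v E j) \<bullet> w) *\<^sub>R xi x - ((G x *v E j) \<bullet> w) *\<^sub>R pd i xi x"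
    using d differentiable x
    by (simp add: pd_scaleR pd_const_matrix_vector_mult pd_const_inner pd_nth)
  finally show ?thesis .
qed

text \<open>The curvature of the rescaled metric vanishes. Expanding it by the change of connection,
  the derivatives of \<open>phi\<close> and the quadratic terms in \<open>phi\<close> assemble into
  \<open>P\<close>, and solving for \<open>Rm G\<close> gives the Kulkarni-Nomizu form.\<close>

lemma Rm_eq:
  assumes x: "x \<in> S"
  shows "Rm G i j x *v w = (P j x \<bullet> w) *\<^sub>R E i - (P i x \<bullet> w) *\<^sub>R E j
    + ((G x *v E j) \<bullet> w) *\<^sub>R (H x *v P i x) - ((G x *v E i) \<bullet> w) *\<^sub>R (H x *v P j x)"
proof -
  have 1: "(pd i G x *v E j) \<bullet> w = (G x *v E j) \<bullet> (Gam G i x *v w) + (G x *v w) \<bullet> (Gam G i x *v E j)"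
    for i j w using pd_G_inner[OF x, of w i "E j"] by (simp add: inner_commute)
  have 2: "(G x *v E i) \<bullet> xi x = phi x $ i" for i
    by (simp add: G_inner x G_xi inner_axis')
  have 3: "phi x \<bullet> E i = phi x $ i" for i by (simp add: inner_axis)
  have 4: "(G x *v E i) \<bullet> E j = (G x *v E j) \<bullet> E i" for i j
    by (metis G_inner[OF x] inner_commute)
  have 5: "H x *v P i x = H x *v Dphi i x - (phi x $ i) *\<^sub>R xi x + ((1/2) * (phi x \<bullet> xi x)) *\<^sub>R E i" for i
    by (simp add: P_def algebra_simps xi_def x)
  \<comment> \<open>On the left \<open>2\<close> is a constant vector and the product is
    componentwise, a form that a sum \<open>v + v\<close> can take after simplification.\<close>
  have 6: "z \<bullet> (v * 2) = 2 * (z \<bullet> v)" for z v :: "real^'n"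
    by (simp only: mult_2_right inner_add_right mult_2)
  have "0 = z \<bullet> (Rm (\<lambda>y. f y *\<^sub>R G y) i j x *v w)" for z
    by (simp add: conf_Rm x)
  then have "z \<bullet> (Rm G i j x *v w) = z \<bullet> ((P j x \<bullet> w) *\<^sub>R E i - (P i x \<bullet> w) *\<^sub>R E j
    + ((G x *v E j) \<bullet> w) *\<^sub>R (H x *v P i x) - ((G x *v E i) \<bullet> w) *\<^sub>R (H x *v P j x))" for z
    unfolding Rm_apply[OF x] conf.Rm_apply[OF x] pd_conf_Gam[OF x] conf_Gam[OF x] pd_phi pd_phi_nth pd_xi[OF x] 1 5
    using Dphi_commute[OF x, of i j] Gam_commute[OF x, of i j]
    by (simp add: P_def algebra_simps inner_add_right inner_diff_right inner_add_left inner_diff_left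
        2 3 4[of i j] 6)
  then show ?thesis using vector_eq_ldot by blast
qed

text \<open>Antisymmetrising the second covariant derivative of \<open>phi\<close> produces
  \<open>phi\<close> applied to the curvature. By \<open>Rm_eq\<close> this is again expressed
  through \<open>P\<close>, and it cancels the antisymmetrised quadratic part of \<open>P\<close>.
  Connection terms acting on the label of \<open>P\<close> are symmetric by torsion-freeness and are
  therefore omitted from both sides.\<close>

lemma cotton:
  assumes x: "x \<in> S"
  shows "pd i (P j) x \<bullet> w - P j x \<bullet> (Gam G i x *v w) = pd j (P i) x \<bullet> w - P i x \<bullet> (Gam G j x *v w)"
proof -
  have 1: "(pd i G x *v E j) \<bullet> w = (G x *v E j) \<bullet> (Gam G i x *v w) + (G x *v w) \<bullet> (Gam G i x *v E j)"
    for i j w using pd_G_inner[OF x, of w i "E j"] by (simp add: inner_commute)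
  have pdP: "pd i (P j) x \<bullet> w = pd i (pd j phi) x \<bullet> w - pd i phi x \<bullet> (Gam G j x *v w)
      - phi x \<bullet> (pd i (Gam G j) x *v w) - pd i phi x $ j * (phi x \<bullet> w) - phi x $ j * (pd i phi x \<bullet> w)
      + (1/2) * (pd i phi x \<bullet> xi x + phi x \<bullet> pd i xi x) * ((G x *v E j) \<bullet> w)
      + (1/2) * (phi x \<bullet> xi x) * ((pd i G x *v E j) \<bullet> w)" for i j
  proof -
    have s: "smooth_on S (\<lambda>y. pd j phi y \<bullet> w)" "smooth_on S (\<lambda>y. phi y \<bullet> (Gam G j y *v w))"
      "smooth_on S (\<lambda>y. phi y $ j * (phi y \<bullet> w))" "smooth_on S (\<lambda>y. (phi y \<bullet> xi y) * ((G y *v E j) \<bullet> w))"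
      "smooth_on S (\<lambda>y. (G y *v E j) \<bullet> w)" "smooth_on S (\<lambda>y. G y *v E j)" "smooth_on S (\<lambda>y. phi y \<bullet> xi y)"
      "smooth_on S (\<lambda>y. phi y $ j)" "smooth_on S (\<lambda>y. phi y \<bullet> w)" "smooth_on S (\<lambda>y. Gam G j y *v w)"
      "smooth_on S (pd j phi)" "smooth_on S (\<lambda>y. phi y v* Gam G j y)" "smooth_on S (P j)"
      unfolding P_def[abs_def] Dphi_def
      by (intro smooth_on_add smooth_on_diff smooth_on_mult smooth_on_matrix_vector_mult smooth_on_scaleR
        smooth_on_inner smooth_on_nth smooth_on_bilinear[OF _ bounded_bilinear_vector_matrix_mult]
        smooth_on_const open_S smooth_Gam smooth_G smooth_phi smooth_xi smooth_on_pd)+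
    note d = s[THEN smooth_on_differentiable, OF x]
    have "pd i (P j) x \<bullet> w = pd i (\<lambda>y. P j y \<bullet> w) x"
      by (rule pd_const_inner[symmetric]) (rule d)
    also have "(\<lambda>y. P j y \<bullet> w) = (\<lambda>y. pd j phi y \<bullet> w - phi y \<bullet> (Gam G j y *v w)
        - phi y $ j * (phi y \<bullet> w) + (1/2) * ((phi y \<bullet> xi y) * ((G y *v E j) \<bullet> w)))"
      by (simp add: fun_eq_iff P_def Dphi_def inner_add_left inner_diff_left dot_lmul_matrix)
    also have "pd i \<dots> x = pd i (\<lambda>y. pd j phi y \<bullet> w) x - pd i (\<lambda>y. phi y \<bullet> (Gam G j y *v w)) x
        - pd i (\<lambda>y. phi y $ j * (phi y \<bullet> w)) x
        + (1/2) * pd i (\<lambda>y. (phi y \<bullet> xi y) * ((G y *v E j) \<bullet> w)) x"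
      by (simp add: pd_add pd_diff pd_linear[OF bounded_linear_divide] d differentiable_diff
          bounded_linear_imp_differentiable differentiable_divide)
    finally show ?thesis
      using d differentiable x
      by (simp add: pd_mult pd_inner pd_const_matrix_vector_mult pd_const_inner pd_nth algebra_simps)
  qed
  \<comment> \<open>The Ricci identity for \<open>phi\<close> enters here: once the second partial
    derivatives cancel, the derivatives of the connection matrices are traded for the
    curvature.\<close>
  have Rm: "phi x \<bullet> (pd i (Gam G j) x *v w) - phi x \<bullet> (pd j (Gam G i) x *v w) =
      phi x \<bullet> (Rm G i j x *v w) - phi x \<bullet> (Gam G i x *v (Gam G j x *v w))
      + phi x \<bullet> (Gam G j x *v (Gam G i x *v w))"
    by (simp add: Rm_apply[OF x] inner_add_right inner_diff_right)
  have 2: "phi x \<bullet> (H x *v v) = xi x \<bullet> v" for v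
    by (metis H_inner[OF x] xi_def)
  have 3: "phi x \<bullet> E i = phi x $ i" for i by (simp add: inner_axis)
  have 4: "(G x *v E i) \<bullet> xi x = phi x $ i" for i
    by (simp add: G_inner x G_xi inner_axis')
  have 5: "Dphi i x = P i x + (phi x $ i) *\<^sub>R phi x - ((1/2) * (phi x \<bullet> xi x)) *\<^sub>R (G x *v E i)" for i
    by (simp add: P_def)
  have pp: "pd i (pd j phi) x \<bullet> w = pd j (pd i phi) x \<bullet> w"
  proof -
    have "pd i (pd j phi) x = pd j (pd i phi) x"
      by (rule pd_commute_vec[OF open_S x smooth_phi])
         (rule pd_commute[OF open_S x smooth_on_nth[OF open_S smooth_phi]])
    then show ?thesis by simp
  qed
  show ?thesis
    unfolding pdP pp
    using Rm phi_closed[OF x, of i j] arg_cong[OF Gam_commute[OF x, of i j], of "\<lambda>v. (G x *v w) \<bullet> v"]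
    unfolding Rm_eq[OF x]
    by (simp add: pd_phi pd_xi x 1 5 inner_add_left inner_diff_left inner_add_right inner_diff_right
        2 3 4 inner_commute[of "xi x"] algebra_simps)
qed

end


subsection \<open>Traces, the Ricci identity and the Schouten tensor\<close>

lemma trace_eq_inner: "trace (M :: real^'n^'n::finite) = (\<Sum>i\<in>UNIV. E i \<bullet> (M *v E i))"
  by (simp add: trace_def nth_eq_inner)

lemmas minus_matrix_vector_mult = bounded_bilinear.minus_left[OF bounded_bilinear_matrix_vector_mult]
lemmas matrix_diff_ldistrib = bounded_bilinear.diff_right[OF bounded_bilinear_matrix_matrix_mult]
lemmas matrix_diff_rdistrib = bounded_bilinear.diff_left[OF bounded_bilinear_matrix_matrix_mult]
lemmas matrix_minus_left = bounded_bilinear.minus_left[OF bounded_bilinear_matrix_matrix_mult]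

lemma bounded_linear_transpose: "bounded_linear (transpose :: real^'n::finite^'m::finite \<Rightarrow> real^'m^'n)"
  unfolding linear_conv_bounded_linear[symmetric]
  by (auto simp: linear_iff transpose_def vec_eq_iff)

lemma bounded_linear_trace: "bounded_linear (trace :: real^'n^'n::finite \<Rightarrow> real)"
  unfolding linear_conv_bounded_linear[symmetric]
  by (auto simp: linear_iff trace_def sum.distrib sum_distrib_left)

lemmas smooth_on_transpose = smooth_on_linear[OF _ bounded_linear_transpose]
lemmas smooth_on_trace = smooth_on_linear[OF _ bounded_linear_trace]

section \<open>Parallel metric, scalar curvature and Ricci identity\<close>

context metric_patch
begin

definition "scal x = trace (H x ** ricci G x)"
definition "schouten x = (1 / (real CARD('n) - 2)) *\<^sub>R
  (ricci G x - (scal x / (2 * (real CARD('n) - 1))) *\<^sub>R G x)"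

lemma smooth_Rm: "smooth_on S (Rm G i j)"
  unfolding Rm_def[abs_def]
  by (intro smooth_on_add smooth_on_diff smooth_on_pd smooth_on_matrix_matrix_mult smooth_Gam open_S)

lemma ricci_nth:
  assumes "x \<in> S"
  shows "(ricci G x *v w) $ j = (\<Sum>i\<in>UNIV. E i \<bullet> (Rm G i j x *v w))"
  by (simp add: ricci_def riemann_eq_Rm assms matrix_vector_mult_def inner_axis' sum_distrib_right)
     (rule sum.swap)

lemma smooth_ricci: "smooth_on S (ricci G)"
proof -
  have "smooth_on S (\<lambda>x. \<chi> j l. \<Sum>i\<in>UNIV. Rm G i j x $ i $ l)"
    by (intro smooth_on_vec_lambda smooth_on_sum smooth_on_nth smooth_Rm open_S)
  then show ?thesis
    by (subst smooth_on_cong[OF open_S, of _ "\<lambda>x. \<chi> j l. \<Sum>i\<in>UNIV. Rm G i j x $ i $ l"])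
       (simp_all add: ricci_def riemann_eq_Rm)
qed

lemma smooth_scal: "smooth_on S scal"
  unfolding scal_def[abs_def]
  by (intro smooth_on_trace smooth_on_matrix_matrix_mult smooth_H smooth_ricci open_S)

lemma nabla_inner:
  "u \<bullet> (nabla G i T x *v v) = u \<bullet> (pd i T x *v v) - (Gam G i x *v u) \<bullet> (T x *v v)
    - u \<bullet> (T x *v (Gam G i x *v v))"
  by (simp add: nabla_def algebra_simps inner_diff_right inner_transpose_matrix
      del: transpose_matrix_vector flip: matrix_vector_mul_assoc)

lemma nabla_metric: "x \<in> S \<Longrightarrow> nabla G i G x = 0"
  by (simp add: nabla_def nabla_G)

lemma nabla_cong:
  assumes "x \<in> S" "smooth_on S T" "\<And>y. y \<in> S \<Longrightarrow> T y = T' y"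
  shows "nabla G i T x = nabla G i T' x"
  using pd_cong[OF open_S assms(1) smooth_on_differentiable[OF assms(2,1)] assms(3)] assms(1,3)
  by (simp add: nabla_def)

lemma nabla_add:
  assumes "T differentiable (at x)" "T' differentiable (at x)"
  shows "nabla G i (\<lambda>y. T y + T' y) x = nabla G i T x + nabla G i T' x"
  by (simp add: nabla_def pd_add assms matrix_add_ldistrib matrix_add_rdistrib)

lemma nabla_scaleR:
  assumes "a differentiable (at x)" "T differentiable (at x)"
  shows "nabla G i (\<lambda>y. a y *\<^sub>R T y) x = pd i a x *\<^sub>R T x + a x *\<^sub>R nabla G i T x"
  using assms
  by (simp add: nabla_def pd_scaleR matrix_scalar_ac scaleR_diff_right flip: scalar_matrix_assoc)

text \<open>The inverse metric is parallel; this is the derivative of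
  \<open>G H = 1\<close>.\<close>

lemma pd_H:
  assumes "x \<in> S"
  shows "pd i H x = - (H x ** transpose (Gam G i x)) - Gam G i x ** H x"
proof -
  have d: "G differentiable (at x)" "H differentiable (at x)"
    using smooth_on_differentiable smooth_G smooth_H assms by blast+
  have "G x ** pd i H x + pd i G x ** H x = pd i (\<lambda>y. G y ** H y) x"
    using d by (simp add: pd_matrix_matrix_mult)
  also have "\<dots> = pd i (\<lambda>y. mat 1) x"
    by (rule pd_cong[OF open_S assms])
       (auto simp: G_H intro!: smooth_on_differentiable[OF smooth_on_matrix_matrix_mult[OF open_S smooth_G smooth_H] assms])
  finally have *: "G x ** pd i H x = - (pd i G x ** H x)" by (simp add: eq_neg_iff_add_eq_0)
  have "u \<bullet> (pd i H x *v v) = u \<bullet> ((- (H x ** transpose (Gam G i x)) - Gam G i x ** H x) *v v)" for u v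
  proof -
    have "u \<bullet> (pd i H x *v v) = (H x *v u) \<bullet> ((G x ** pd i H x) *v v)"
      by (simp add: H_inner assms flip: matrix_vector_mul_assoc)
    also have "\<dots> = - ((H x *v u) \<bullet> (pd i G x *v (H x *v v)))"
      unfolding * by (metis inner_minus_right matrix_vector_mul_assoc minus_matrix_vector_mult)
    also have "\<dots> = - ((Gam G i x *v (H x *v u)) \<bullet> v) - u \<bullet> (Gam G i x *v (H x *v v))"
      by (simp add: pd_G_inner assms)
    also have "\<dots> = u \<bullet> ((- (H x ** transpose (Gam G i x)) - Gam G i x ** H x) *v v)"
      by (simp add: algebra_simps inner_diff_right inner_transpose_matrix H_inner[OF assms, of u, symmetric] assms
          minus_matrix_vector_mult
          del: transpose_matrix_vector flip: matrix_vector_mul_assoc)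
    finally show ?thesis .
  qed
  then show ?thesis using matrix_eq_inner by blast
qed

text \<open>Since \<open>H\<close> is parallel, the metric trace commutes with \<open>nabla\<close>;
  cyclicity of the trace matches the remaining connection terms.\<close>

lemma pd_trace:
  assumes "x \<in> S" "T differentiable (at x)"
  shows "pd i (\<lambda>y. trace (H y ** T y)) x = trace (H x ** nabla G i T x)"
proof -
  have d: "H differentiable (at x)" "(\<lambda>y. H y ** T y) differentiable (at x)"
    using smooth_on_differentiable[OF smooth_H assms(1)] assms(2)
      bounded_bilinear.FDERIV[OF bounded_bilinear_matrix_matrix_mult]
    unfolding differentiable_def by blast+
  have "pd i (\<lambda>y. trace (H y ** T y)) x = trace (H x ** pd i T x + pd i H x ** T x)"
    using d assms by (simp add: pd_linear[OF bounded_linear_trace] pd_matrix_matrix_mult)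
  also have "\<dots> = trace (H x ** pd i T x) - trace (H x ** transpose (Gam G i x) ** T x)
      - trace (Gam G i x ** (H x ** T x))"
    by (simp add: pd_H assms matrix_diff_rdistrib matrix_minus_left trace_add trace_sub matrix_mul_assoc linear_neg[OF bounded_linear.linear[OF bounded_linear_trace]])
  also have "trace (Gam G i x ** (H x ** T x)) = trace (H x ** T x ** Gam G i x)"
    by (rule trace_mul_sym)
  finally show ?thesis
    by (simp add: nabla_def matrix_diff_ldistrib trace_sub matrix_mul_assoc)
qed

lemma pd_scal:
  assumes "x \<in> S"
  shows "pd i scal x = trace (H x ** nabla G i (ricci G) x)"
  using pd_trace[OF assms smooth_on_differentiable[OF smooth_ricci assms]]
  by (simp add: scal_def[abs_def])

text \<open>Second partial derivatives commute and the mixed first-order terms are symmetric in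
  \<open>i\<close> and \<open>j\<close>. What survives is the curvature acting on each of the two
  slots of \<open>T\<close>.\<close>

lemma ricci_identity:
  assumes x: "x \<in> S" and T: "smooth_on S T"
  shows "nabla G i (nabla G j T) x - nabla G j (nabla G i T) x =
    - (transpose (Rm G i j x) ** T x) - T x ** Rm G i j x"
proof -
  have pd2: "pd i (pd j T) x = pd j (pd i T) x"
    by (intro pd_commute_vec[OF open_S x] pd_commute[OF open_S x] smooth_on_nth open_S T)
  have 1: "pd i (nabla G j T) x = pd i (pd j T) x - transpose (pd i (Gam G j) x) ** T x
      - transpose (Gam G j x) ** pd i T x - pd i T x ** Gam G j x - T x ** pd i (Gam G j) x" for i j
  proof -
    have s: "smooth_on S (pd j T)" "smooth_on S (\<lambda>y. transpose (Gam G j y) ** T y)"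
      "smooth_on S (\<lambda>y. T y ** Gam G j y)" "smooth_on S (\<lambda>y. transpose (Gam G j y))"
      by (intro smooth_on_pd smooth_on_matrix_matrix_mult smooth_on_transpose smooth_Gam open_S T)+
    note d = s[THEN smooth_on_differentiable, OF x] smooth_on_differentiable[OF T x]
      smooth_on_differentiable[OF smooth_Gam x]
    show ?thesis
      using d unfolding nabla_def[abs_def]
      by (simp add: pd_diff pd_matrix_matrix_mult pd_linear[OF bounded_linear_transpose] differentiable_diff)
  qed
  have "u \<bullet> ((nabla G i (nabla G j T) x - nabla G j (nabla G i T) x) *v v) =
    u \<bullet> ((- (transpose (Rm G i j x) ** T x) - T x ** Rm G i j x) *v v)" for u v
    by (simp add: nabla_inner 1 pd2 matrix_vector_mult_diff_rdistrib minus_matrix_vector_mult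
        inner_diff_right inner_diff_left inner_transpose_matrix Rm_apply[OF x]
        matrix_vector_mult_diff_distrib matrix_vector_right_distrib inner_add_left inner_add_right
        del: transpose_matrix_vector flip: matrix_vector_mul_assoc)
  then show ?thesis using matrix_eq_inner by blast
qed

end

section \<open>The Schouten tensor of a conformally flat metric\<close>

context conformally_flat_patch
begin

lemma P_commute: "x \<in> S \<Longrightarrow> P i x \<bullet> E j = P j x \<bullet> E i"
  using Dphi_commute[of x i j] G_inner[of x "E i" "E j"]
  by (simp add: P_def inner_add_left inner_diff_left inner_axis inner_axis' mult.commute)

text \<open>The trace of \<open>Rm_eq\<close>. The factor \<open>n - 2\<close> is \<open>n\<close>
  from the trace of the identity, minus 1 from each of the two negative terms.\<close>

lemma ricci_P:
  assumes x: "x \<in> S"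
  shows "E j \<bullet> (ricci G x *v w) = (real CARD('n) - 2) * (P j x \<bullet> w) +
    (\<Sum>i\<in>UNIV. E i \<bullet> (H x *v P i x)) * (E j \<bullet> (G x *v w))"
proof -
  have "E j \<bullet> (ricci G x *v w) = (\<Sum>i\<in>UNIV. E i \<bullet> (Rm G i j x *v w))"
    by (simp add: ricci_nth x inner_axis')
  also have "\<dots> = (\<Sum>i\<in>UNIV. (P j x \<bullet> w) - (P i x \<bullet> w) * (E i \<bullet> E j)
     + (E j \<bullet> (G x *v w)) * (E i \<bullet> (H x *v P i x)) - (G x *v w) $ i * (H x *v P j x) $ i)"
    by (simp add: Rm_eq x inner_add_right inner_diff_right G_inner inner_axis' inner_axis_axis)
  also have "\<dots> = real CARD('n) * (P j x \<bullet> w) - P j x \<bullet> w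
     + (E j \<bullet> (G x *v w)) * (\<Sum>i\<in>UNIV. E i \<bullet> (H x *v P i x)) - (G x *v w) \<bullet> (H x *v P j x)"
    by (simp add: sum.distrib sum_subtractf sum_distrib_left inner_vec_def[of "G x *v w"] inner_axis_axis
       if_distrib[of "\<lambda>r. _ * r"] cong: if_cong)
  also have "(G x *v w) \<bullet> (H x *v P j x) = P j x \<bullet> w"
    by (simp add: G_inner x inner_commute)
  finally show ?thesis by (simp add: algebra_simps)
qed

text \<open>\<open>P\<close> is recovered from its trace: with \<open>J\<close> the trace of
  \<open>P\<close>, the Ricci tensor is \<open>(n - 2) P + J G\<close>, so the scalar curvature is
  \<open>2 (n - 1) J\<close>. Solving for \<open>P\<close> gives the formula defining
  \<open>schouten\<close>.\<close>

lemma schouten_P: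
  assumes x: "x \<in> S" and n: "CARD('n) > 2"
  shows "schouten x *v E j = P j x" "E j \<bullet> (schouten x *v w) = P j x \<bullet> w"
proof -
  define M where "M = (\<chi> j l. P j x $ l)"
  define J where "J = (\<Sum>i\<in>UNIV. E i \<bullet> (H x *v P i x))"
  have M: "E j \<bullet> (M *v w) = P j x \<bullet> w" for j w
    by (simp add: M_def inner_axis' matrix_vector_mul_component vec_lambda_eta)
  have M': "M *v E j = P j x" for j
    using P_commute[OF x, of _ j] by (simp add: vec_eq_iff M flip: inner_axis[of _ _ 1]) (simp add: inner_axis M_def matrix_vector_mul_component vec_lambda_eta)
  have "E j \<bullet> (ricci G x *v w) = E j \<bullet> (((real CARD('n) - 2) *\<^sub>R M + J *\<^sub>R G x) *v w)" for j w
    by (simp add: ricci_P x M algebra_simps inner_add_right J_def flip: scaleR_matrix_vector_assoc)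
  then have ric: "ricci G x = (real CARD('n) - 2) *\<^sub>R M + J *\<^sub>R G x"
    unfolding vec_eq_iff nth_eq_inner by blast
  have "trace (H x ** M) = J"
    by (simp add: trace_eq_inner J_def M' flip: matrix_vector_mul_assoc)
  then have "scal x = (real CARD('n) - 2) * J + J * real CARD('n)"
    by (simp add: scal_def ric matrix_add_ldistrib matrix_scalar_ac trace_add G_H x trace_I
      linear_cmul[OF bounded_linear.linear[OF bounded_linear_trace]] flip: scalar_matrix_assoc)
  then have J: "scal x / (2 * (real CARD('n) - 1)) = J" using n by (simp add: field_simps)
  have S: "schouten x = M"
    using n unfolding schouten_def J ric by simp
  show "schouten x *v E j = P j x" "E j \<bullet> (schouten x *v w) = P j x \<bullet> w"
    by (simp_all add: S M M')
qed

lemma Rm_schouten: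
  assumes x: "x \<in> S" and n: "CARD('n) > 2"
  shows "Rm G i j x *v w = (E j \<bullet> (schouten x *v w)) *\<^sub>R E i - (E i \<bullet> (schouten x *v w)) *\<^sub>R E j
    + (E j \<bullet> (G x *v w)) *\<^sub>R (H x *v (schouten x *v E i)) - (E i \<bullet> (G x *v w)) *\<^sub>R (H x *v (schouten x *v E j))"
  unfolding schouten_P[OF x n] Rm_eq[OF x] by (simp add: G_inner x)

lemma schouten_commute:
  assumes x: "x \<in> S" and n: "CARD('n) > 2"
  shows "transpose (schouten x) = schouten x"
proof -
  have "E j \<bullet> (schouten x *v E i) = E i \<bullet> (schouten x *v E j)" for i j
    using P_commute[OF x, of i j] by (simp add: schouten_P x n inner_commute)
  then show ?thesis by (simp add: vec_eq_iff nth_eq_inner transpose_def)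
qed

lemma cotton_schouten:
  assumes x: "x \<in> S" and n: "CARD('n) > 2"
  shows "E j \<bullet> (nabla G i schouten x *v w) = E i \<bullet> (nabla G j schouten x *v w)"
proof -
  have s: "smooth_on S schouten" unfolding schouten_def[abs_def]
    by (intro smooth_on_scaleR smooth_on_diff smooth_on_const smooth_on_divide smooth_ricci smooth_G open_S smooth_scal)
      (use n in simp)
  have "E j \<bullet> (pd i schouten x *v w) = pd i (P j) x \<bullet> w" for i j
  proof -
    have "E j \<bullet> (pd i schouten x *v w) = pd i (\<lambda>y. E j \<bullet> (schouten y *v w)) x"
      using pd_const_inner[of "\<lambda>y. schouten y *v w" x i "E j"]
        smooth_on_differentiable[OF smooth_on_matrix_vector_mult[OF open_S s smooth_on_const] x]
        smooth_on_differentiable[OF s x]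
      by (simp add: inner_commute pd_const_matrix_vector_mult)
    also have "\<dots> = pd i (\<lambda>y. P j y \<bullet> w) x"
      by (rule pd_cong[OF open_S x])
         (auto simp: schouten_P n intro!: smooth_on_differentiable[OF _ x] smooth_on_inner
           smooth_on_matrix_vector_mult open_S s smooth_on_const)
    also have "\<dots> = pd i (P j) x \<bullet> w"
    proof (rule pd_const_inner)
      have "smooth_on S (\<lambda>y. schouten y *v E j)"
        by (intro smooth_on_matrix_vector_mult open_S s smooth_on_const)
      then have "smooth_on S (P j)"
        by (subst (asm) smooth_on_cong[OF open_S schouten_P(1)[OF _ n]])
      then show "P j differentiable at x" using smooth_on_differentiable x by blast
    qed
    finally show ?thesis .
  qed
  then show ?thesis
    using cotton[OF x, of i j w] by (simp add: nabla_inner schouten_P x n Gam_commute[OF x, of i j])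
qed

end


subsection \<open>Linear algebra of the recurrence condition\<close>

lemma orthogonal_to_two_exists:
  fixes a b :: "real^'n::finite"
  assumes "CARD('n) > 2"
  obtains z where "z \<noteq> 0" "a \<bullet> z = 0" "b \<bullet> z = 0"
proof -
  have "dim {a, b} \<le> card {a, b}" by (intro dim_le_card') simp
  also have "\<dots> < DIM(real^'n)" using assms card_insert_le_m1[of 2 "{b}" a] by auto
  finally obtain z where z: "z \<noteq> 0" "\<And>y. y \<in> span {a, b} \<Longrightarrow> orthogonal z y"
    using orthogonal_to_subspace_exists by blast
  then have "a \<bullet> z = 0" "b \<bullet> z = 0"
    using span_base[of a "{a, b}"] span_base[of b "{a, b}"] by (auto simp: orthogonal_def inner_commute)
  with z that show ?thesis by blast
qed

text \<open>Contraction of an equation between 2-vectors, \<open>a\<close> wedge \<open>b\<close>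
  equal to \<open>c\<close> wedge \<open>d\<close>, with the vector \<open>z\<close>.\<close>

lemma wedge_contract:
  fixes a b c d :: "real^'n::finite"
  assumes "\<And>i j. a $ i * b $ j - a $ j * b $ i = c $ i * d $ j - c $ j * d $ i"
  shows "(a \<bullet> z) *\<^sub>R b - (b \<bullet> z) *\<^sub>R a = (c \<bullet> z) *\<^sub>R d - (d \<bullet> z) *\<^sub>R c"
proof -
  have *: "((a \<bullet> z) *\<^sub>R b - (b \<bullet> z) *\<^sub>R a) $ j = (\<Sum>i\<in>UNIV. z $ i * (a $ i * b $ j - a $ j * b $ i))"
    for a b :: "real^'n" and j
    by (simp add: inner_vec_def sum_distrib_left sum_distrib_right sum_subtractf algebra_simps)
  show ?thesis unfolding vec_eq_iff * assms by simp
qed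

text \<open>Contracting with \<open>a\<close> in the Euclidean inner product, which is positive
  although \<open>a\<close> may be null for \<open>G\<close>, determines \<open>R w\<close> modulo
  \<open>a\<close> and \<open>c\<close>. Once \<open>c\<close> is a multiple of \<open>a\<close>,
  the map \<open>R - m G\<close> has values in the line of \<open>a\<close>; by symmetry it is then
  a multiple of \<open>a a\<close>, and evaluation at \<open>a\<close> gives
  \<open>v\<close>.\<close>

lemma quasi_einstein_decomposition:
  fixes G R :: "real^'n^'n::finite" and a c :: "real^'n"
  assumes n: "CARD('n) > 2" and G: "transpose G = G" "invertible G" and R: "transpose R = R"
    and a: "a \<noteq> 0"
    and eq: "\<And>i j w. a $ i * (R *v w) $ j - a $ j * (R *v w) $ i = c $ i * (G *v w) $ j - c $ j * (G *v w) $ i"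
  defines "m \<equiv> (c \<bullet> a) / (a \<bullet> a)"
  defines "v \<equiv> (a \<bullet> (R *v a) - m * (a \<bullet> (G *v a))) / (a \<bullet> a)\<^sup>2"
  shows "c = m *\<^sub>R a" "R *v w = m *\<^sub>R (G *v w) + (v * (a \<bullet> w)) *\<^sub>R a"
proof -
  have aa: "a \<bullet> a > 0" using a by simp
  have symG: "(G *v u) \<bullet> w = u \<bullet> (G *v w)" and symR: "(R *v u) \<bullet> w = u \<bullet> (R *v w)" for u w
    using inner_transpose_matrix[of u G w] inner_transpose_matrix[of u R w] G R by auto
  define d where "d = c - m *\<^sub>R a"
  have c: "c = m *\<^sub>R a + d" by (simp add: d_def)
  have ca: "c \<bullet> a = m * (a \<bullet> a)" using aa by (simp add: m_def)
  have 1: "(a \<bullet> a) *\<^sub>R (R *v w) - ((R *v w) \<bullet> a) *\<^sub>R a = (c \<bullet> a) *\<^sub>R (G *v w) - ((G *v w) \<bullet> a) *\<^sub>R c" for w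
    by (rule wedge_contract[OF eq])
  have "d = 0"
  proof -
    \<comment> \<open>With \<open>z\<close> orthogonal to \<open>a\<close> and \<open>d\<close>, and
      \<open>w\<close> its preimage under \<open>G\<close>, the hypothesis collapses to
      \<open>d\<close> wedge \<open>z\<close> being zero. Contraction with \<open>z\<close> then
      kills \<open>d\<close>.\<close>
    obtain z where z: "z \<noteq> 0" "a \<bullet> z = 0" "d \<bullet> z = 0"
      using orthogonal_to_two_exists[OF n] by blast
    obtain w where w: "G *v w = z"
      using G(2) matrix_inv_mult(1)[OF G(2)] by (metis matrix_vector_mul_assoc matrix_vector_mul_lid)
    have zz: "z \<bullet> z > 0" using z by simp
    have e: "(a \<bullet> a) * (R *v w) $ j = ((R *v w) \<bullet> a) * a $ j + m * (a \<bullet> a) * z $ j" for j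
      using arg_cong[OF 1[of w], of "\<lambda>u. u $ j"] z unfolding w ca by (simp add: inner_commute algebra_simps)
    have "d $ i * z $ j - d $ j * z $ i = 0" for i j
    proof -
      have "(a \<bullet> a) * (a $ i * (R *v w) $ j - a $ j * (R *v w) $ i) = (a \<bullet> a) * (c $ i * z $ j - c $ j * z $ i)"
        using eq[of i w j] by (simp add: w)
      moreover have "(a \<bullet> a) * (a $ i * (R *v w) $ j - a $ j * (R *v w) $ i) =
        a $ i * ((a \<bullet> a) * (R *v w) $ j) - a $ j * ((a \<bullet> a) * (R *v w) $ i)" by (simp add: algebra_simps)
      ultimately have "(a \<bullet> a) * (d $ i * z $ j - d $ j * z $ i) = 0"
        unfolding e by (auto simp: c algebra_simps)
      with aa show ?thesis by simp
    qed
    then have "(d \<bullet> z) *\<^sub>R z - (z \<bullet> z) *\<^sub>R d = (0 \<bullet> z) *\<^sub>R 0 - (0 \<bullet> z) *\<^sub>R 0"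
      by (intro wedge_contract) simp
    then show "d = 0" using z zz by simp
  qed
  then show c_eq: "c = m *\<^sub>R a" by (simp add: c)
  define q where "q w = a \<bullet> (R *v w) - m * (a \<bullet> (G *v w))" for w
  have 2: "(a \<bullet> a) *\<^sub>R (R *v w - m *\<^sub>R (G *v w)) = q w *\<^sub>R a" for w
    using 1[of w] unfolding c_eq q_def by (simp add: algebra_simps inner_commute)
  have "(a \<bullet> a) * q w = (a \<bullet> w) * q a"
  proof -
    have "(a \<bullet> a) * q w = w \<bullet> ((a \<bullet> a) *\<^sub>R (R *v a - m *\<^sub>R (G *v a)))"
      using symR[of a w] symG[of a w] by (simp add: q_def inner_diff_right inner_commute algebra_simps)
    then show ?thesis by (simp only: 2) (simp add: inner_commute)
  qed
  then have "q w = (a \<bullet> a) * (v * (a \<bullet> w))"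
    using aa by (simp add: v_def q_def[of a, symmetric] field_simps power2_eq_square)
  then have "(a \<bullet> a) *\<^sub>R (R *v w - m *\<^sub>R (G *v w)) = (a \<bullet> a) *\<^sub>R ((v * (a \<bullet> w)) *\<^sub>R a)"
    using 2[of w] by simp
  then have "R *v w - m *\<^sub>R (G *v w) = (v * (a \<bullet> w)) *\<^sub>R a"
    using aa by (simp only: scaleR_cancel_left) auto
  then show "R *v w = m *\<^sub>R (G *v w) + (v * (a \<bullet> w)) *\<^sub>R a"
    by (simp add: algebra_simps)
qed

text \<open>Choose \<open>u\<close> Euclidean-orthogonal to \<open>a\<close> and \<open>G a\<close>,
  so that \<open>z = G u\<close> is orthogonal to \<open>a\<close>. The pair \<open>(u, z)\<close>
  isolates \<open>p\<close> and shows that it vanishes; the pair \<open>(u, a)\<close> then leaves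
  \<open>k\<close> times \<open>a\<close> wedge \<open>z\<close>, which is nonzero unless
  \<open>k = 0\<close>.\<close>

lemma integrability_coefficient_zero:
  fixes G :: "real^'n^'n::finite" and a :: "real^'n"
  assumes n: "CARD('n) > 2" and G: "transpose G = G" "invertible G" and a: "a \<noteq> 0"
    and eq: "\<And>i j u w. k * ((a \<bullet> u) * (a $ i * (G *v w) $ j - a $ j * (G *v w) $ i)
        + (a \<bullet> w) * (a $ i * (G *v u) $ j - a $ j * (G *v u) $ i)) =
      p i j * (u \<bullet> (G *v w)) + q i j * (a \<bullet> u) * (a \<bullet> w)"
  shows "k = 0"
proof (rule ccontr)
  assume k: "k \<noteq> 0"
  obtain u where u: "u \<noteq> 0" "a \<bullet> u = 0" "(G *v a) \<bullet> u = 0"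
    using orthogonal_to_two_exists[OF n] by blast
  define z where "z = G *v u"
  have symG: "(G *v u) \<bullet> w = u \<bullet> (G *v w)" for u w
    using inner_transpose_matrix[of u G w] G by auto
  have z: "z \<noteq> 0"
    using u(1) matrix_inv_mult(2)[OF G(2)] unfolding z_def
    by (metis matrix_vector_mul_assoc matrix_vector_mul_lid matrix_vector_mult_0_right)
  have az: "a \<bullet> z = 0" using u(3) symG[of a u] by (simp add: z_def)
  have "u \<bullet> (G *v z) = z \<bullet> z" by (simp add: z_def flip: symG)
  then have p: "p i j = 0" for i j
    using eq[of u i z j] u az z by simp
  have "a $ i * z $ j - a $ j * z $ i = 0" for i j
    using eq[of u i a j] u(2) k a by (simp add: p z_def)
  then have "(a \<bullet> a) *\<^sub>R z - (z \<bullet> a) *\<^sub>R a = (0 \<bullet> a) *\<^sub>R 0 - (0 \<bullet> a) *\<^sub>R 0"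
    by (intro wedge_contract) simp
  then show False using a z az by (simp add: inner_commute)
qed

subsection \<open>Recurrence on a chart\<close>

locale recurrent_patch = metric_patch S G for S :: "(real^4) set" and G +
  fixes A B :: "real^4 \<Rightarrow> real^4"
  assumes smooth_A: "smooth_on S A" and smooth_B: "smooth_on S B"
    and A_nonzero: "x \<in> S \<Longrightarrow> A x \<noteq> 0" and B_nonzero: "x \<in> S \<Longrightarrow> B x \<noteq> 0"
    and recurrence: "x \<in> S \<Longrightarrow> nabla G i (ricci G) x = (A x $ i) *\<^sub>R ricci G x + (B x $ i) *\<^sub>R G x"
    and conformally_flat: "x \<in> S \<Longrightarrow> \<exists>U f. x \<in> U \<and> U \<subseteq> S \<and> conformally_flat_patch U G f"
begin

text \<open>These statements at \<open>x\<close> involve only \<open>G\<close> and its derivatives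
  there; \<open>H\<close>, \<open>scal\<close> and \<open>schouten\<close> are the same on
  \<open>U\<close> as on \<open>S\<close>. They can thus be read off from a conformally flat patch
  around \<open>x\<close>.\<close>

lemma
  assumes "x \<in> S"
  shows Rm_eq_schouten: "Rm G i j x *v w = (E j \<bullet> (schouten x *v w)) *\<^sub>R E i - (E i \<bullet> (schouten x *v w)) *\<^sub>R E j
    + (E j \<bullet> (G x *v w)) *\<^sub>R (H x *v (schouten x *v E i)) - (E i \<bullet> (G x *v w)) *\<^sub>R (H x *v (schouten x *v E j))"
    and transpose_schouten: "transpose (schouten x) = schouten x"
    and cotton_zero: "E j \<bullet> (nabla G i schouten x *v w) = E i \<bullet> (nabla G j schouten x *v w)"
proof -
  obtain U f where U: "x \<in> U" "conformally_flat_patch U G f"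
    using conformally_flat[OF assms] by blast
  interpret U: conformally_flat_patch U G f by (rule U)
  show "Rm G i j x *v w = (E j \<bullet> (schouten x *v w)) *\<^sub>R E i - (E i \<bullet> (schouten x *v w)) *\<^sub>R E j
    + (E j \<bullet> (G x *v w)) *\<^sub>R (H x *v (schouten x *v E i)) - (E i \<bullet> (G x *v w)) *\<^sub>R (H x *v (schouten x *v E j))"
    by (rule U.Rm_schouten[OF U(1)]) simp
  show "transpose (schouten x) = schouten x" by (rule U.schouten_commute[OF U(1)]) simp
  show "E j \<bullet> (nabla G i schouten x *v w) = E i \<bullet> (nabla G j schouten x *v w)"
    by (rule U.cotton_schouten[OF U(1)]) simp
qed

lemma ricci_eq: "ricci G x = 2 *\<^sub>R schouten x + (scal x / 6) *\<^sub>R G x"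
  by (simp add: schouten_def)

lemma transpose_ricci: "x \<in> S \<Longrightarrow> transpose (ricci G x) = ricci G x"
  by (simp add: ricci_eq linear_add[OF bounded_linear.linear[OF bounded_linear_transpose]]
      transpose_scalar transpose_schouten sym_G)

lemmas differentiable =
  smooth_on_differentiable[OF smooth_A] smooth_on_differentiable[OF smooth_B]
  smooth_on_differentiable[OF smooth_scal] smooth_on_differentiable[OF smooth_G]
  smooth_on_differentiable[OF smooth_ricci] smooth_on_differentiable[OF smooth_H]

lemma pd_scal_eq:
  assumes "x \<in> S"
  shows "pd i scal x = A x $ i * scal x + 4 * B x $ i"
  by (simp add: pd_scal assms recurrence matrix_add_ldistrib matrix_scalar_ac trace_add G_H trace_I
      linear_cmul[OF bounded_linear.linear[OF bounded_linear_trace]] flip: scalar_matrix_assoc)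
    (simp add: scal_def)

text \<open>\<open>K\<close> is the form for which the Cotton identity reads
  \<open>A\<^sub>i R\<^sub>j\<^sub>l - A\<^sub>j R\<^sub>i\<^sub>l = K\<^sub>i g\<^sub>j\<^sub>l - K\<^sub>j g\<^sub>i\<^sub>l\<close>.\<close>

definition "K x = (scal x / 6) *\<^sub>R A x - (1/3) *\<^sub>R B x"
text \<open>The coefficients from \<open>quasi_einstein_decomposition\<close>. Their denominators
  are Euclidean and hence positive, which also makes \<open>nu\<close> smooth where \<open>A\<close>
  is null.\<close>

definition "mu x = (K x \<bullet> A x) / (A x \<bullet> A x)"
definition "nu x = (A x \<bullet> (ricci G x *v A x) - mu x * (A x \<bullet> (G x *v A x))) / (A x \<bullet> A x)\<^sup>2"

lemma nabla_schouten:
  assumes "x \<in> S"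
  shows "nabla G i schouten x = (1/2) *\<^sub>R ((A x $ i) *\<^sub>R ricci G x - (K x $ i) *\<^sub>R G x)"
proof -
  have s: "smooth_on S (\<lambda>y. 2 *\<^sub>R schouten y)" "smooth_on S (\<lambda>y. (scal y / 6) *\<^sub>R G y)" "smooth_on S schouten"
      "smooth_on S (\<lambda>y. scal y / 6)"
    unfolding schouten_def[abs_def]
    by (intro smooth_on_scaleR smooth_on_diff smooth_on_const smooth_on_divide smooth_ricci smooth_G open_S smooth_scal; simp)+
  note d = s[THEN smooth_on_differentiable, OF assms]
  have "nabla G i (ricci G) x = nabla G i (\<lambda>y. 2 *\<^sub>R schouten y + (scal y / 6) *\<^sub>R G y) x"
    by (rule nabla_cong[OF assms smooth_ricci ricci_eq])
  also have "\<dots> = 2 *\<^sub>R nabla G i schouten x + (pd i scal x / 6) *\<^sub>R G x"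
    using d differentiable assms
    by (simp add: nabla_add nabla_scaleR nabla_metric pd_linear[OF bounded_linear_divide])
  finally have "2 *\<^sub>R nabla G i schouten x =
      (A x $ i) *\<^sub>R ricci G x + (B x $ i) *\<^sub>R G x - ((A x $ i * scal x + 4 * B x $ i) / 6) *\<^sub>R G x"
    by (simp add: recurrence assms pd_scal_eq)
  also have "\<dots> = (A x $ i) *\<^sub>R ricci G x - (K x $ i) *\<^sub>R G x"
    by (simp add: K_def vec_eq_iff field_simps)
  finally have "2 *\<^sub>R nabla G i schouten x = (A x $ i) *\<^sub>R ricci G x - (K x $ i) *\<^sub>R G x" .
  from arg_cong[OF this, of "scaleR (1/2)"] show ?thesis by simp
qed

lemma
  assumes x: "x \<in> S"
  shows K_eq: "K x = mu x *\<^sub>R A x"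
    and ricci_decomposition: "ricci G x *v w = mu x *\<^sub>R (G x *v w) + (nu x * (A x \<bullet> w)) *\<^sub>R A x"
proof -
  have "A x $ i * (ricci G x *v w) $ j - A x $ j * (ricci G x *v w) $ i =
      K x $ i * (G x *v w) $ j - K x $ j * (G x *v w) $ i" for i j w
    using cotton_zero[OF x, of j i w]
    by (simp add: nabla_schouten x algebra_simps inner_diff_right inner_axis' flip: scaleR_matrix_vector_assoc)
  note d = quasi_einstein_decomposition[OF _ sym_G[OF x] invertible_G[OF x] transpose_ricci[OF x] A_nonzero[OF x] this]
  show "K x = mu x *\<^sub>R A x"
    unfolding mu_def by (rule d) simp
  show "ricci G x *v w = mu x *\<^sub>R (G x *v w) + (nu x * (A x \<bullet> w)) *\<^sub>R A x"
    unfolding nu_def mu_def by (rule d) simp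
qed

lemma B_eq: "x \<in> S \<Longrightarrow> B x = (scal x / 2 - 3 * mu x) *\<^sub>R A x"
  using K_eq[of x] by (simp add: K_def vec_eq_iff field_simps)

lemma scal_eq:
  assumes x: "x \<in> S"
  shows "scal x = 4 * mu x + nu x * (A x \<bullet> (H x *v A x))"
proof -
  have "scal x = (\<Sum>i\<in>UNIV. E i \<bullet> (H x *v (ricci G x *v E i)))"
    by (simp add: scal_def trace_eq_inner flip: matrix_vector_mul_assoc)
  also have "\<dots> = (\<Sum>i\<in>UNIV. mu x + nu x * (A x $ i * (H x *v A x) $ i))"
    by (intro sum.cong refl)
       (simp add: ricci_decomposition x algebra_simps inner_add_right inner_axis' inner_axis)
  also have "\<dots> = 4 * mu x + nu x * (A x \<bullet> (H x *v A x))"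
    by (simp add: sum.distrib inner_vec_def sum_distrib_left)
  finally show ?thesis .
qed

lemma schouten_decomposition:
  assumes x: "x \<in> S"
  shows "schouten x *v w = ((mu x - scal x / 6) / 2) *\<^sub>R (G x *v w) + (nu x / 2 * (A x \<bullet> w)) *\<^sub>R A x"
  by (simp add: schouten_def matrix_vector_mult_diff_rdistrib ricci_decomposition[OF x]
      flip: scaleR_matrix_vector_assoc) (simp add: vec_eq_iff field_simps)

text \<open>In the Kulkarni-Nomizu form the terms quadratic in \<open>A\<close> cancel by
  antisymmetry in \<open>i\<close> and \<open>j\<close>. The coefficient that remains is simplified
  by writing \<open>scal\<close> in terms of \<open>mu\<close> and \<open>nu\<close>.\<close>

lemma A_Rm:
  assumes x: "x \<in> S"
  shows "A x \<bullet> (Rm G i j x *v w) = ((mu x + nu x * (A x \<bullet> (H x *v A x))) / 3) *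
    (A x $ i * (G x *v w) $ j - A x $ j * (G x *v w) $ i)"
proof -
  have s: "scal x / 6 = (4 * mu x + nu x * (A x \<bullet> (H x *v A x))) / 6" by (simp add: scal_eq x)
  show ?thesis
    unfolding Rm_eq_schouten[OF x] schouten_decomposition[OF x] s
    by (simp add: inner_add_right inner_diff_right inner_axis inner_axis' matrix_vector_right_distrib
        matrix_vector_mult_scaleR x) (simp add: field_simps)
qed

lemma Rm_skew:
  assumes x: "x \<in> S"
  shows "(Rm G i j x *v u) \<bullet> (G x *v w) = - (u \<bullet> (G x *v (Rm G i j x *v w)))"
proof -
  have 1: "(H x *v v) \<bullet> (G x *v w) = v \<bullet> w" for v w by (simp add: H_inner x)
  have 2: "(schouten x *v u) \<bullet> w = u \<bullet> (schouten x *v w)" for u w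
    by (metis inner_transpose_matrix transpose_schouten[OF x])
  have 3: "u \<bullet> (G x *v E k) = E k \<bullet> (G x *v u)" "u \<bullet> (schouten x *v E k) = E k \<bullet> (schouten x *v u)" for u k
    using 2 G_inner[OF x] by (metis inner_commute)+
  show ?thesis
    unfolding Rm_eq_schouten[OF x]
    by (simp add: inner_add_left inner_diff_left inner_add_right inner_diff_right 1 x 3
        matrix_vector_right_distrib matrix_vector_mult_diff_distrib matrix_vector_mult_scaleR 2)
qed

text \<open>The Ricci identity is applied to the Ricci tensor, with second derivatives computed from
  the recurrence. On the curvature side the part \<open>mu G\<close> drops out by skewness of the
  curvature, and \<open>A_Rm\<close> evaluates the part \<open>nu A A\<close>. The result has the
  shape treated by \<open>integrability_coefficient_zero\<close>.\<close>

lemma integrability: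
  assumes x: "x \<in> S"
  shows "nu x * (mu x + nu x * (A x \<bullet> (H x *v A x))) = 0"
proof -
  have n2: "nabla G i (nabla G j (ricci G)) x = (pd i A x $ j) *\<^sub>R ricci G x
    + (A x $ j) *\<^sub>R ((A x $ i) *\<^sub>R ricci G x + (B x $ i) *\<^sub>R G x) + (pd i B x $ j) *\<^sub>R G x" for i j
  proof -
    have s: "smooth_on S (\<lambda>y. (A y $ j) *\<^sub>R ricci G y)" "smooth_on S (\<lambda>y. (B y $ j) *\<^sub>R G y)"
       "smooth_on S (\<lambda>y. A y $ j)" "smooth_on S (\<lambda>y. B y $ j)"
      by (intro smooth_on_scaleR smooth_on_nth open_S smooth_A smooth_B smooth_ricci smooth_G)+
    note d = s[THEN smooth_on_differentiable, OF x] differentiable[OF x]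
    have "nabla G i (nabla G j (ricci G)) x = nabla G i (\<lambda>y. (A y $ j) *\<^sub>R ricci G y + (B y $ j) *\<^sub>R G y) x"
    proof (rule nabla_cong[OF x])
      show "smooth_on S (nabla G j (ricci G))"
        unfolding nabla_def[abs_def]
        by (intro smooth_on_diff smooth_on_pd smooth_on_matrix_matrix_mult smooth_on_transpose
            smooth_Gam open_S smooth_ricci)
    qed (rule recurrence)
    also have "\<dots> = (pd i A x $ j) *\<^sub>R ricci G x
      + (A x $ j) *\<^sub>R ((A x $ i) *\<^sub>R ricci G x + (B x $ i) *\<^sub>R G x) + (pd i B x $ j) *\<^sub>R G x"
      using d by (simp add: nabla_add nabla_scaleR nabla_metric x recurrence pd_nth)
    finally show ?thesis .
  qed
  \<comment> \<open>\<open>F\<close> is the exterior derivative of \<open>A\<close>, and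
    \<open>Q\<close> that of \<open>B\<close> minus \<open>A\<close> wedge \<open>B\<close>.\<close>
  define F where "F i j = pd i A x $ j - pd j A x $ i" for i j
  define Q where "Q i j = pd i B x $ j - pd j B x $ i + A x $ j * B x $ i - A x $ i * B x $ j" for i j
  have id: "- (transpose (Rm G i j x) ** ricci G x) - ricci G x ** Rm G i j x = F i j *\<^sub>R ricci G x + Q i j *\<^sub>R G x" for i j
    unfolding ricci_identity[OF x smooth_ricci, symmetric] n2
    by (simp add: F_def Q_def algebra_simps)
  define k where "k = (mu x + nu x * (A x \<bullet> (H x *v A x))) / 3"
  have id': "- ((Rm G i j x *v u) \<bullet> (ricci G x *v w)) - u \<bullet> (ricci G x *v (Rm G i j x *v w)) =
      F i j * (u \<bullet> (ricci G x *v w)) + Q i j * (u \<bullet> (G x *v w))" for i j u w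
    using arg_cong[OF id[of i j], of "\<lambda>M. u \<bullet> (M *v w)"]
    by (simp add: matrix_vector_mult_diff_rdistrib minus_matrix_vector_mult matrix_vector_mult_add_rdistrib
        inner_diff_right inner_add_right inner_transpose_matrix
        del: transpose_matrix_vector flip: matrix_vector_mul_assoc scaleR_matrix_vector_assoc)
  have "nu x * k = 0"
  proof (rule integrability_coefficient_zero[OF _ sym_G[OF x] invertible_G[OF x] A_nonzero[OF x]])
    fix i j u w
    show "nu x * k * ((A x \<bullet> u) * (A x $ i * (G x *v w) $ j - A x $ j * (G x *v w) $ i)
        + (A x \<bullet> w) * (A x $ i * (G x *v u) $ j - A x $ j * (G x *v u) $ i)) =
      (- (F i j * mu x + Q i j)) * (u \<bullet> (G x *v w)) + (- (F i j * nu x)) * (A x \<bullet> u) * (A x \<bullet> w)"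
      using id'[of i j u w]
      unfolding ricci_decomposition[OF x] inner_add_right inner_scaleR_right Rm_skew[OF x] A_Rm[OF x, folded k_def]
        inner_commute[of _ "A x"]
      by (simp add: algebra_simps)
  qed simp
  then show ?thesis by (simp add: k_def)
qed

section \<open>The Einstein condition and constant curvature\<close>

lemma smooth_nu: "smooth_on S nu"
  unfolding nu_def[abs_def] mu_def K_def
  by (intro smooth_on_divide smooth_on_diff smooth_on_mult smooth_on_inner smooth_on_scaleR
      smooth_on_matrix_vector_mult smooth_on_const smooth_A smooth_B smooth_ricci smooth_G smooth_scal open_S;
      use A_nonzero in \<open>simp add: smooth_on_inner open_S smooth_A power2_eq_square smooth_on_mult\<close>)

lemma nu_zero:
  assumes x: "x \<in> S"
  shows "nu x = 0"
proof (rule ccontr)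
  assume nz: "nu x \<noteq> 0"
  \<comment> \<open>The relation saying that \<open>a\<close> lies in the kernel of the Ricci tensor
    has to be differentiated, so it must hold on an open set and not only at
    \<open>x\<close>.\<close>
  define V where "V = S \<inter> nu -` (- {0})"
  have V: "open V" "x \<in> V" "V \<subseteq> S"
    using continuous_open_preimage[OF smooth_on_continuous[OF smooth_nu] open_S, of "- {0}"] nz x
    by (auto simp: V_def)
  define a where "a y = H y *v A y" for y
  have mu: "mu y = - (nu y * (A y \<bullet> a y))" if "y \<in> V" for y
    using integrability[of y] that by (auto simp: V_def a_def eq_neg_iff_add_eq_0)
  have Ra: "ricci G y *v a y = 0" if "y \<in> V" for y
  proof -
    have "ricci G y *v a y = (mu y + nu y * (A y \<bullet> a y)) *\<^sub>R A y"
      using that by (simp add: ricci_decomposition V_def a_def algebra_simps)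
    then show ?thesis using mu[OF that] by simp
  qed
  have s: "smooth_on S a" "smooth_on S (\<lambda>y. ricci G y *v a y)" "smooth_on S (\<lambda>y. a y \<bullet> (ricci G y *v a y))"
    unfolding a_def[abs_def]
    by (intro smooth_on_inner smooth_on_matrix_vector_mult smooth_H smooth_A smooth_ricci open_S)+
  note d = s[THEN smooth_on_differentiable, OF x] differentiable[OF x]
  have R_sym: "u \<bullet> (ricci G x *v w) = (ricci G x *v u) \<bullet> w" for u w
    using inner_transpose_matrix[of u "ricci G x" w] transpose_ricci[OF x] by simp
  \<comment> \<open>Derivatives falling on \<open>a\<close>, and the connection terms, meet the
    Ricci tensor applied to \<open>a\<close> and vanish. Hence the covariant derivative of the Ricci
    tensor is zero on \<open>(a, a)\<close>, and the recurrence reduces it to \<open>B\<close> times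
    the squared length of \<open>A\<close>.\<close>
  have "B x $ i * (A x \<bullet> a x) = 0" for i
  proof -
    have "a x \<bullet> (pd i (ricci G) x *v a x) = pd i (\<lambda>y. a y \<bullet> (ricci G y *v a y)) x"
      using d by (simp add: pd_inner pd_matrix_vector_mult Ra V inner_add_right R_sym)
    also have "\<dots> = pd i (\<lambda>y. 0) x"
      by (rule pd_cong[OF V(1,2) d(3)]) (simp add: Ra)
    finally have "a x \<bullet> (nabla G i (ricci G) x *v a x) = 0"
      by (simp add: nabla_inner R_sym Ra V)
    then show ?thesis
      by (simp add: recurrence x matrix_vector_mult_add_rdistrib inner_add_right Ra V
          flip: scaleR_matrix_vector_assoc) (simp add: a_def x inner_commute)
  qed
  moreover obtain i where "B x $ i \<noteq> 0" using B_nonzero[OF x] by (auto simp: vec_eq_iff)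
  ultimately have "A x \<bullet> a x = 0" by auto
  then have "mu x = 0" "scal x = 0"
    using mu[OF V(2)] scal_eq[OF x] by (simp_all add: a_def)
  then show False using B_eq[OF x] B_nonzero[OF x] by simp
qed

text \<open>With \<open>nu = 0\<close> the trace gives \<open>mu = s/4\<close>. Then
  \<open>s/2 - 3 mu = - s/4\<close>, and the Schouten coefficient is
  \<open>(s/4 - s/6)/2 = s/24\<close>.\<close>

lemma einstein:
  assumes x: "x \<in> S"
  shows "B x = - (scal x / 4) *\<^sub>R A x" "pd i scal x = 0"
    "schouten x *v w = (scal x / 24) *\<^sub>R (G x *v w)"
proof -
  have mu: "mu x = scal x / 4" using scal_eq[OF x] nu_zero[OF x] by simp
  show B: "B x = - (scal x / 4) *\<^sub>R A x" using B_eq[OF x] by (simp add: mu)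
  show "pd i scal x = 0" by (simp add: pd_scal_eq x B)
  show "schouten x *v w = (scal x / 24) *\<^sub>R (G x *v w)"
    using schouten_decomposition[OF x, of w] by (simp add: mu nu_zero x)
qed

text \<open>A Schouten tensor \<open>(s/24) G\<close> enters the Kulkarni-Nomizu form twice, so the
  curvature is that of constant curvature \<open>s/12\<close>.\<close>

lemma sectional_eq:
  assumes x: "x \<in> S" and "area2 (G x) u v \<noteq> 0"
  shows "sectional G x u v = scal x / 12"
proof -
  have ax: "E i $ l = (if i = l then 1 else 0)" for i l :: 4 by (simp add: axis_def)
  have Rm: "(Rm G i j x *v w) $ l = (scal x / 12) *
      ((G x *v w) $ j * (if i = l then 1 else 0) - (G x *v w) $ i * (if j = l then 1 else 0))" for i j l w
    unfolding Rm_eq_schouten[OF x] einstein(3)[OF x]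
    by (simp add: x matrix_vector_mult_scaleR inner_axis' ax)
  have "curvature_op G x u v v $ l = (\<Sum>i\<in>UNIV. \<Sum>j\<in>UNIV. u $ i * v $ j * (Rm G i j x *v v) $ l)" for l
    by (simp add: curvature_op_def riemann_eq_Rm x matrix_vector_mult_def sum_distrib_left mult_ac)
  also have "\<dots> l = (scal x / 12) * (bilin (G x) v v * u $ l - bilin (G x) u v * v $ l)" for l
  proof -
    have "(\<Sum>i\<in>UNIV. \<Sum>j\<in>UNIV. u $ i * v $ j * (Rm G i j x *v v) $ l) =
      (\<Sum>i\<in>UNIV. \<Sum>j\<in>UNIV. (scal x / 12) * ((if i = l then u $ i * (v $ j * (G x *v v) $ j) else 0)
        - (if j = l then v $ j * (u $ i * (G x *v v) $ i) else 0)))"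
      by (intro sum.cong refl) (simp add: Rm)
    also have "\<dots> = (scal x / 12) * ((\<Sum>i\<in>UNIV. \<Sum>j\<in>UNIV. if i = l then u $ i * (v $ j * (G x *v v) $ j) else 0)
        - (\<Sum>i\<in>UNIV. \<Sum>j\<in>UNIV. if j = l then v $ j * (u $ i * (G x *v v) $ i) else 0))"
      by (simp only: sum_subtractf sum_distrib_left[symmetric])
    also have "(\<Sum>i\<in>UNIV. \<Sum>j\<in>UNIV. if i = l then u $ i * (v $ j * (G x *v v) $ j) else 0) = bilin (G x) v v * u $ l"
      by (subst sum.swap) (simp add: bilin_def inner_vec_def sum_distrib_left mult.commute)
    also have "(\<Sum>i\<in>UNIV. \<Sum>j\<in>UNIV. if j = l then v $ j * (u $ i * (G x *v v) $ i) else 0) = bilin (G x) u v * v $ l"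
      by (simp add: bilin_def inner_vec_def sum_distrib_left mult.commute)
    finally show ?thesis .
  qed
  finally have R: "curvature_op G x u v v = (scal x / 12) *\<^sub>R (bilin (G x) v v *\<^sub>R u - bilin (G x) u v *\<^sub>R v)"
    by (simp add: vec_eq_iff)
  have "bilin (G x) (curvature_op G x u v v) u = (scal x / 12) * area2 (G x) u v"
    unfolding R using G_inner[OF x, of v u]
    by (simp add: bilin_def area2_def inner_diff_left power2_eq_square inner_commute algebra_simps)
  then show ?thesis using assms(2) by (simp add: sectional_def)
qed

end


subsection \<open>Spacetimes\<close>

lemma is_chart_inverse:
  assumes "is_chart c"
  shows "p \<in> chart_dom c \<Longrightarrow> chart_inv c (chart_map c p) = p"
    "x \<in> chart_image c \<Longrightarrow> chart_inv c x \<in> chart_dom c"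
    "x \<in> chart_image c \<Longrightarrow> chart_map c (chart_inv c x) = x"
  using assms unfolding is_chart_def homeomorphism_def by auto

lemma open_chart_map_image:
  assumes "is_chart c" "open W"
  shows "open (chart_map c ` (chart_dom c \<inter> W))"
proof -
  have "openin (top_of_set (chart_image c)) (chart_map c ` (chart_dom c \<inter> W))"
    using assms by (intro homeomorphism_imp_open_map[of "chart_dom c" _ _ "chart_inv c"])
      (auto simp: is_chart_def openin_open)
  then show ?thesis using assms(1) openin_open_trans unfolding is_chart_def by blast
qed

lemma recurrent_patch_chart:
  fixes g :: "('m::{t2_space, second_countable_topology}, 4) tensor2"
  assumes st: "spacetime \<A> g" and cf: "conformally_flat \<A> g"
    and A: "smooth_one_form \<A> A" "nowhere_vanishing \<A> A"
    and B: "smooth_one_form \<A> B" "nowhere_vanishing \<A> B"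
    and rec: "\<forall>c\<in>\<A>. \<forall>x\<in>chart_image c. \<forall>i j l.
           cov_deriv2 (g c) (ricci (g c)) i j l x =
             A c x $ i * ricci (g c) x $ j $ l + B c x $ i * g c x $ j $ l"
    and c: "c \<in> \<A>"
  shows "recurrent_patch (chart_image c) (g c) (A c) (B c)"
proof -
  have ch: "is_chart c" using st c by (auto simp: spacetime_def smooth_atlas_def)
  have g: "smooth_on (chart_image c) (g c)"
    "\<And>x. x \<in> chart_image c \<Longrightarrow> transpose (g c x) = g c x"
    "\<And>x. x \<in> chart_image c \<Longrightarrow> invertible (g c x)"
    using st c by (auto simp: spacetime_def lorentzian_metric_def pseudo_riemannian_metric_def smooth_tensor2_def)
  interpret metric_patch "chart_image c" "g c"
    by standard (use ch g in \<open>auto simp: is_chart_def\<close>)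
  show ?thesis
  proof
    show "smooth_on (chart_image c) (A c)" "smooth_on (chart_image c) (B c)"
      using A B c by (auto simp: smooth_one_form_def)
    show "A c x \<noteq> 0" "B c x \<noteq> 0" if "x \<in> chart_image c" for x
      using A B c that by (auto simp: nowhere_vanishing_def)
    show "nabla (g c) i (ricci (g c)) x = (A c x $ i) *\<^sub>R ricci (g c) x + (B c x $ i) *\<^sub>R g c x"
      if "x \<in> chart_image c" for x i
      using rec c that
      by (simp add: vec_eq_iff flip: cov_deriv2_eq_nabla[OF smooth_on_differentiable[OF smooth_ricci that]])
    fix x assume x: "x \<in> chart_image c"
    obtain W f where W: "open W" "chart_inv c x \<in> W" "smooth_function_on \<A> W f"
      "\<forall>q\<in>W. f q > 0" "flat_on \<A> W (rescale f g)"
      using cf unfolding conformally_flat_def by metis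
    \<comment> \<open>The coordinate image of the part of \<open>W\<close> that the chart covers; on
      it the conformal factor is read through \<open>chart_inv c\<close>.\<close>
    define U where "U = chart_map c ` (chart_dom c \<inter> W)"
    have U: "open U" "U \<subseteq> chart_image c"
      using open_chart_map_image[OF ch W(1)] by (auto simp: U_def chart_image_def)
    have xU: "x \<in> U"
      unfolding U_def using is_chart_inverse(2,3)[OF ch x] W(2) by (metis IntI imageI)
    have "conformally_flat_patch U (g c) (\<lambda>y. f (chart_inv c y))"
    proof
      show "smooth_on U (g c)" using smooth_on_subset[OF g(1) U(2)] .
      show "smooth_on U (\<lambda>y. f (chart_inv c y))"
        using W(3) c by (auto simp: smooth_function_on_def U_def)
      show "f (chart_inv c y) > 0" if "y \<in> U" for y
        using that W(4) is_chart_inverse(1)[OF ch] by (auto simp: U_def)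
      show "riemann (\<lambda>y. f (chart_inv c y) *\<^sub>R g c y) l i j k y = 0" if "y \<in> U" for y l i j k
        using W(5) c that by (auto simp: flat_on_def rescale_def U_def)
    qed (use U g in auto)
    with xU U show "\<exists>U f. x \<in> U \<and> U \<subseteq> chart_image c \<and> conformally_flat_patch U (g c) f" by blast
  qed
qed

section \<open>From single charts to the connected spacetime\<close>

lemma constant_if_pd_zero:
  fixes f :: "real^'n::finite \<Rightarrow> 'b::real_normed_vector"
  assumes "convex S" "\<And>x. x \<in> S \<Longrightarrow> f differentiable (at x)" "\<And>i x. x \<in> S \<Longrightarrow> pd i f x = 0"
    and "x \<in> S" "y \<in> S"
  shows "f x = f y"
proof (rule has_derivative_zero_unique[OF assms(1) _ assms(4,5)])
  fix x assume x: "x \<in> S"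
  have lin: "linear (frechet_derivative f (at x))"
    by (rule linear_frechet_derivative[OF assms(2)[OF x]])
  have "frechet_derivative f (at x) h = 0" for h
  proof -
    have "frechet_derivative f (at x) h = frechet_derivative f (at x) (\<Sum>i\<in>UNIV. (h $ i) *\<^sub>R axis i 1)"
      using basis_expansion[of h] by (simp add: scalar_mult_eq_scaleR)
    also have "\<dots> = 0"
      using assms(3)[OF x] by (simp add: linear_sum[OF lin] linear_cmul[OF lin] pd_def)
    finally show ?thesis .
  qed
  then have "frechet_derivative f (at x) = (\<lambda>h. 0)" by auto
  then show "(f has_derivative (\<lambda>h. 0)) (at x within S)"
    using assms(2)[OF x] by (metis frechet_derivative_works has_derivative_at_withinI)
qed

theorem corollary1p1:
  fixes \<A> :: "('m::{t2_space, second_countable_topology}, 4) chart set"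
    and g :: "('m, 4) tensor2"
  assumes "spacetime \<A> g"
    and "conformally_flat \<A> g"
    and "generalized_ricci_recurrent \<A> g"
  shows "de_sitter \<A> g \<or> anti_de_sitter \<A> g"
proof -
  obtain A B where AB: "smooth_one_form \<A> A" "smooth_one_form \<A> B"
    "nowhere_vanishing \<A> A" "nowhere_vanishing \<A> B"
    "\<forall>c\<in>\<A>. \<forall>x\<in>chart_image c. \<forall>i j l. cov_deriv2 (g c) (ricci (g c)) i j l x =
             A c x $ i * ricci (g c) x $ j $ l + B c x $ i * g c x $ j $ l"
    using assms(3) unfolding generalized_ricci_recurrent_def by blast
  note rp = recurrent_patch_chart[OF assms(1,2) AB(1,3,2,4,5)]
  have at: "connected (UNIV :: 'm set)" "\<And>c. c \<in> \<A> \<Longrightarrow> is_chart c" "(\<Union>c\<in>\<A>. chart_dom c) = UNIV"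
    using assms(1) by (auto simp: spacetime_def smooth_atlas_def)
  define s where "s c x = metric_patch.scal (g c) x" for c x
  have im: "chart_map c p \<in> chart_image c" if "p \<in> chart_dom c" for c :: "('m, 4) chart" and p
    using that by (simp add: chart_image_def)
  have B_A: "B c x = - (s c x / 4) *\<^sub>R A c x" if "c \<in> \<A>" "x \<in> chart_image c" for c x
    using recurrent_patch.einstein(1)[OF rp[OF that(1)] that(2)] by (simp add: s_def)
  have A_nz: "A c x \<noteq> 0" "B c x \<noteq> 0" if "c \<in> \<A>" "x \<in> chart_image c" for c x
    using AB(3,4) that by (auto simp: nowhere_vanishing_def)
  text \<open>The scalar curvature is chart independent because \<open>A\<close> and \<open>B\<close> are tensorial and
    \<open>B = - (s / 4) A\<close>; its own transformation law is not needed.\<close>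
  have chart_indep: "s c (chart_map c p) = s d (chart_map d p)"
    if "c \<in> \<A>" "d \<in> \<A>" "p \<in> chart_dom c" "p \<in> chart_dom d" for c d p
  proof -
    define x where "x = chart_map c p"
    define M where "M = transpose (jacobian (transition c d) (at x))"
    have x: "x \<in> chart_map c ` (chart_dom c \<inter> chart_dom d)" "transition c d x = chart_map d p"
      using that is_chart_inverse(1)[OF at(2)] by (auto simp: x_def transition_def)
    have A: "A c x = M *v A d (chart_map d p)" and B: "B c x = M *v B d (chart_map d p)"
      using AB(1,2) that x unfolding smooth_one_form_def M_def by metis+
    have "B c x = - (s d (chart_map d p) / 4) *\<^sub>R A c x"
      unfolding B B_A[OF that(2) im[OF that(4)]] A by (rule matrix_vector_mult_scaleR)
    moreover have "B c x = - (s c x / 4) *\<^sub>R A c x" "A c x \<noteq> 0"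
      using B_A A_nz that im unfolding x_def by blast+
    ultimately show ?thesis by (simp add: x_def)
  qed
  have "\<exists>c. c \<in> \<A> \<and> p \<in> chart_dom c" for p
    using at(3) by (metis UNIV_I UN_E)
  then obtain ch where ch: "ch p \<in> \<A>" "p \<in> chart_dom (ch p)" for p
    by metis
  \<comment> \<open>The scalar curvature as a function on the manifold, read in a chosen chart at
    each point; \<open>chart_indep\<close> makes the choice immaterial.\<close>
  define m where "m p = s (ch p) (chart_map (ch p) p)" for p
  have m: "m p = s c (chart_map c p)" if "c \<in> \<A>" "p \<in> chart_dom c" for c p
    unfolding m_def by (rule chart_indep) (use ch that in auto)
  have const: "m p = m q" for p q
  proof (rule connected_local_const[OF at(1) UNIV_I UNIV_I], rule ballI)
    fix p :: 'm
    let ?c = "ch p"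
    interpret recurrent_patch "chart_image ?c" "g ?c" "A ?c" "B ?c" by (rule rp[OF ch(1)])
    \<comment> \<open>A chart image may be neither convex nor connected, so vanishing partial
      derivatives are exploited on a ball only. This gives local constancy, and connectedness of the
      spacetime does the rest.\<close>
    obtain r where r: "r > 0" "ball (chart_map ?c p) r \<subseteq> chart_image ?c"
      using open_S im[OF ch(2)] openE by blast
    have sc: "s ?c x = s ?c (chart_map ?c p)" if "x \<in> ball (chart_map ?c p) r" for x
      unfolding s_def
    proof (rule constant_if_pd_zero[OF convex_ball])
      show "scal differentiable (at y)" "pd i scal y = 0" if "y \<in> ball (chart_map ?c p) r" for y i
        using differentiable(3) einstein(2) r that by blast+
    qed (use that r in auto)
    have cont: "continuous_on (chart_dom ?c) (chart_map ?c)" and op: "open (chart_dom ?c)"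
      using at(2)[OF ch(1)] by (auto simp: is_chart_def homeomorphism_def)
    have V: "open (chart_dom ?c \<inter> chart_map ?c -` ball (chart_map ?c p) r)" (is "open ?V")
      by (rule continuous_open_preimage[OF cont op open_ball])
    have "m p = m q" if "q \<in> ?V" for q
      using that sc m[OF ch(1), of q] m[OF ch(1), of p] ch(2) by auto
    moreover have "p \<in> ?V" using ch(2) r by auto
    ultimately show "eventually (\<lambda>q. m p = m q) (at p within UNIV)"
      unfolding eventually_at_topological using V by blast
  qed
  \<comment> \<open>Since \<open>m\<close> is constant, \<open>undefined\<close> serves as an
    arbitrary base point; the divisor 12 comes from \<open>sectional_eq\<close>.\<close>
  define K where "K = m undefined / 12"
  have sK: "s c x = 12 * K" if "c \<in> \<A>" "x \<in> chart_image c" for c x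
    using m[OF that(1), of "chart_inv c x"] const[of "chart_inv c x" undefined]
      is_chart_inverse(2,3)[OF at(2)[OF that(1)] that(2)] by (simp add: K_def)
  have "constant_sectional_curvature \<A> g K"
    unfolding constant_sectional_curvature_def
    using recurrent_patch.sectional_eq[OF rp] sK by (simp add: s_def)
  \<comment> \<open>If \<open>K\<close> were zero, the scalar curvature and with it
    \<open>B = - (s/4) A\<close> would vanish.\<close>
  moreover have "K \<noteq> 0"
    using B_A[OF ch(1) im[OF ch(2)]] A_nz(2)[OF ch(1) im[OF ch(2)]] sK[OF ch(1) im[OF ch(2)]]
    by force
  ultimately show ?thesis
    using assms(1) unfolding de_sitter_def anti_de_sitter_def by (meson linorder_neqE)
qed


end
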